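(* Let $\mathbf Z=(Z_1,Z_2)^\top\sim SN_2(\boldsymbol\alpha,R)$ with correlation $\rho\in(-1,1)$ and $\alpha_1\neq0$. Consider $u\to0^+$. (a) If $B(u)\to-\infty$ and $A_1(u)\to-\infty$, $0$ or $\infty$, then $\beta_1>0$ and $$P(Z_1\le F_1^{-1}(u)\mid Z_2=F_2^{-1}(u))\sim\frac{e^{-\frac{A_1^2(u)}{2(1-\rho^2)}-\frac12B^2(u)}}{2\pi\sqrt{1-\rho^2}\,\beta_1\,|F_2^{-1}(u)|\,\Phi(\lambda_2F_2^{-1}(u))\,|B(u)|}.$$ (b) If $B(u)\to0$, then $A_1(u)\to-\infty$ and $$P(Z_1\le F_1^{-1}(u)\mid Z_2=F_2^{-1}(u))\sim\frac{\sqrt{1-\rho^2}\,e^{-\frac{A_1^2(u)}{2(1-\rho^2)}}}{2\sqrt{2\pi}\,|A_1(u)|\,\Phi(\lambda_2F_2^{-1}(u))}.$$ (c) If $B(u)\to\infty$, then $A_1(u)\to-\infty$ and $$P(Z_1\le F_1^{-1}(u)\mid Z_2=F_2^{-1}(u))\sim\frac{\sqrt{1-\rho^2}\,e^{-\frac{A_1^2(u)}{2(1-\rho^2)}}}{\sqrt{2\pi}\,|A_1(u)|\,\Phi(\lambda_2F_2^{-1}(u))}.$$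
   Context: $\mathbf Z\sim SN_2(\boldsymbol\alpha,R)$ (bivariate skew normal), $\boldsymbol\alpha=(\alpha_1,\alpha_2)^\top\in\mathbb R^2$, $R=\begin{pmatrix}1&\rho\\ \rho&1\end{pmatrix}$, $-1<\rho<1$, means $\mathbf Z$ has density $2\phi_2(\mathbf z,R)\Phi(\boldsymbol\alpha^\top\mathbf z)$, where $\phi_2(\cdot,R)$ is the bivariate normal density with mean $\mathbf0$ and correlation matrix $R$ and $\Phi$ is the standard normal cdf. The marginal $Z_i$ has density $2\phi(z)\Phi(\lambda_iz)$ ($\phi$ the standard normal density) with $\lambda_i=\frac{\alpha_i+\rho\alpha_{3-i}}{\sqrt{1+\alpha_{3-i}^2(1-\rho^2)}}$, $i=1,2$; $F_i$ is its cdf. The conditional probability is $$P(Z_1\le F_1^{-1}(u)\mid Z_2=F_2^{-1}(u))=\int_{-\infty}^{F_1^{-1}(u)}\frac{1}{\sqrt{2\pi(1-\rho^2)}}e^{-\frac{(z_1-\rho F_2^{-1}(u))^2}{2(1-\rho^2)}}\frac{\Phi(\alpha_1z_1+\alpha_2F_2^{-1}(u))}{\Phi(\lambda_2F_2^{-1}(u))}\,dz_1.$$ Notation: $A_1(u)=F_1^{-1}(u)-\rho F_2^{-1}(u)$, $B(u)=\alpha_1F_1^{-1}(u)+\alpha_2F_2^{-1}(u)$, and $$\beta_1=\frac{\gamma_1-\rho}{1-\rho^2}+\alpha_1(\alpha_1\gamma_1+\alpha_2),\qquad \gamma_1=\lim_{u\to0^+}\frac{F_1^{-1}(u)}{F_2^{-1}(u)}=\begin{cases}\sqrt{(1+\lambda_2^2)/(1+\lambda_1^2)},&\lambda_1>0,\lambda_2>0;\\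 \sqrt{1+\lambda_2^2},&\lambda_1\le0,\lambda_2>0;\\ 1/\sqrt{1+\lambda_1^2},&\lambda_1>0,\lambda_2\le0;\\ 1,&\lambda_1\le0,\lambda_2\le0.\end{cases}$$ $f\sim g$ means $f(u)/g(u)\to1$ as $u\to0^+$. *)

theory Defs
  imports "HOL-Probability.Probability" "HOL-Library.Landau_Symbols"
begin

abbreviation std_normal_cdf :: "real \<Rightarrow> real" where
  "std_normal_cdf \<equiv> cdf std_normal_distribution"

definition binormal_density :: "real \<Rightarrow> real \<times> real \<Rightarrow> real" where
  "binormal_density \<rho> z =
     exp (- ((fst z)\<^sup>2 - 2 * \<rho> * fst z * snd z + (snd z)\<^sup>2) / (2 * (1 - \<rho>\<^sup>2)))
       / (2 * pi * sqrt (1 - \<rho>\<^sup>2))"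

definition sn2_density :: "real \<times> real \<Rightarrow> real \<Rightarrow> real \<times> real \<Rightarrow> real" where
  "sn2_density \<alpha> \<rho> z = 2 * binormal_density \<rho> z * std_normal_cdf (\<alpha> \<bullet> z)"

text \<open>Densities on the plane are with respect to the two-dimensional Lebesgue measure.\<close>

definition skew_normal2 :: "'a measure \<Rightarrow> ('a \<Rightarrow> real \<times> real) \<Rightarrow> real \<times> real \<Rightarrow> real \<Rightarrow> bool" where
  "skew_normal2 M Z \<alpha> \<rho> \<longleftrightarrow> distributed M lborel Z (\<lambda>z. ennreal (sn2_density \<alpha> \<rho> z))"

text \<open>
  The inverse function of the cdf, meaningful only where the cdf is invertible. For the two marginals
  of a skew normal vector this holds on the open unit interval, see \<open>skew_normal2_quantile\<close> and
  \<open>sn_dist_cdf_strict_mono\<close> below.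
\<close>

definition quantile :: "'a measure \<Rightarrow> ('a \<Rightarrow> real) \<Rightarrow> real \<Rightarrow> real" where
  "quantile M X = inv (cdf (distr M borel X))"

text \<open>
  For a joint density \<open>f\<close>, the conditional probability that the first component is at most \<open>x\<close>, given
  that the second one equals \<open>y\<close>. For the skew normal density, \<open>cond_cdf_sn2\<close> below gives the explicit
  integral.
\<close>

definition cond_cdf :: "(real \<times> real \<Rightarrow> real) \<Rightarrow> real \<Rightarrow> real \<Rightarrow> real" where
  "cond_cdf f x y = (LINT z:{..x}|lborel. f (z, y)) / (LINT z|lborel. f (z, y))"

abbreviation quantile1 :: "'a measure \<Rightarrow> ('a \<Rightarrow> real \<times> real) \<Rightarrow> real \<Rightarrow> real" where
  "quantile1 M Z \<equiv> quantile M (\<lambda>\<omega>. fst (Z \<omega>))"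

abbreviation quantile2 :: "'a measure \<Rightarrow> ('a \<Rightarrow> real \<times> real) \<Rightarrow> real \<Rightarrow> real" where
  "quantile2 M Z \<equiv> quantile M (\<lambda>\<omega>. snd (Z \<omega>))"

definition sn2_lambda1 :: "real \<times> real \<Rightarrow> real \<Rightarrow> real" where
  "sn2_lambda1 \<alpha> \<rho> = (fst \<alpha> + \<rho> * snd \<alpha>) / sqrt (1 + (snd \<alpha>)\<^sup>2 * (1 - \<rho>\<^sup>2))"

definition sn2_lambda2 :: "real \<times> real \<Rightarrow> real \<Rightarrow> real" where
  "sn2_lambda2 \<alpha> \<rho> = (snd \<alpha> + \<rho> * fst \<alpha>) / sqrt (1 + (fst \<alpha>)\<^sup>2 * (1 - \<rho>\<^sup>2))"

definition sn2_A1 :: "'a measure \<Rightarrow> ('a \<Rightarrow> real \<times> real) \<Rightarrow> real \<Rightarrow> real \<Rightarrow> real" where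
  "sn2_A1 M Z \<rho> u = quantile1 M Z u - \<rho> * quantile2 M Z u"

definition sn2_B :: "'a measure \<Rightarrow> ('a \<Rightarrow> real \<times> real) \<Rightarrow> real \<times> real \<Rightarrow> real \<Rightarrow> real" where
  "sn2_B M Z \<alpha> u = fst \<alpha> * quantile1 M Z u + snd \<alpha> * quantile2 M Z u"

text \<open>The limit exists; \<open>sn2_gamma1_tendsto\<close> below also gives its closed form.\<close>

definition sn2_gamma1 :: "'a measure \<Rightarrow> ('a \<Rightarrow> real \<times> real) \<Rightarrow> real" where
  "sn2_gamma1 M Z = Lim (at_right 0) (\<lambda>u. quantile1 M Z u / quantile2 M Z u)"

definition sn2_beta1 :: "'a measure \<Rightarrow> ('a \<Rightarrow> real \<times> real) \<Rightarrow> real \<times> real \<Rightarrow> real \<Rightarrow> real" where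
  "sn2_beta1 M Z \<alpha> \<rho> = (sn2_gamma1 M Z - \<rho>) / (1 - \<rho>\<^sup>2)
     + fst \<alpha> * (fst \<alpha> * sn2_gamma1 M Z + snd \<alpha>)"

lemma ennreal_std_normal_cdf:
  "ennreal (std_normal_cdf x) = (\<integral>\<^sup>+t. ennreal (std_normal_density t) * indicator {..x} t \<partial>lborel)"
proof -
  interpret N: prob_space std_normal_distribution by (rule prob_space_normal_density) simp
  have "ennreal (std_normal_cdf x) = emeasure std_normal_distribution {..x}"
    by (simp add: cdf_def N.emeasure_eq_measure)
  also have "\<dots> = (\<integral>\<^sup>+t. ennreal (std_normal_density t) * indicator {..x} t \<partial>lborel)"
    by (rule emeasure_density) auto
  finally show ?thesis .
qed

lemma std_normal_cdf_measurable [measurable]: "std_normal_cdf \<in> borel_measurable borel"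
proof -
  interpret N: prob_space std_normal_distribution by (rule prob_space_normal_density) simp
  interpret R: finite_borel_measure std_normal_distribution
    by standard auto
  have "mono std_normal_cdf" by (auto intro!: monoI R.cdf_nondecreasing)
  then show ?thesis by (rule borel_measurable_mono)
qed

lemma std_normal_cdf_bounds: "0 \<le> std_normal_cdf x" "std_normal_cdf x \<le> 1"
proof -
  interpret N: prob_space std_normal_distribution by (rule prob_space_normal_density) simp
  show "0 \<le> std_normal_cdf x" "std_normal_cdf x \<le> 1" by (auto simp: cdf_def)
qed

lemma binormal_density_eq:
  assumes "-1 < \<rho>" "\<rho> < 1"
  shows "binormal_density \<rho> (x, y) =
    normal_density (\<rho> * y) (sqrt (1 - \<rho>\<^sup>2)) x * std_normal_density y"
proof -
  have r: "1 - \<rho>\<^sup>2 > 0" using assms by (simp add: abs_square_less_1)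
  have e: "- (x\<^sup>2 - 2 * \<rho> * x * y + y\<^sup>2) / (2 * (1 - \<rho>\<^sup>2)) = - (x - \<rho> * y)\<^sup>2 / (2 * (1 - \<rho>\<^sup>2)) + - y\<^sup>2 / 2"
    using r by (simp add: divide_simps) (simp add: power2_eq_square algebra_simps)
  have "sqrt (2 * pi) * sqrt (2 * pi) * sqrt (1 - \<rho>\<^sup>2) = 2 * pi * sqrt (1 - \<rho>\<^sup>2)"
    by (subst real_sqrt_mult_self) simp
  then have s: "sqrt (2 * pi * (1 - \<rho>\<^sup>2)) * sqrt (2 * pi) = 2 * pi * sqrt (1 - \<rho>\<^sup>2)"
    by (subst real_sqrt_mult) (simp add: ac_simps)
  have p: "(sqrt (1 - \<rho>\<^sup>2))\<^sup>2 = 1 - \<rho>\<^sup>2" using r by simp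
  show ?thesis
    unfolding binormal_density_def fst_conv snd_conv e exp_add normal_density_def p s[symmetric]
    by simp
qed

lemma binormal_density_swap: "binormal_density \<rho> (y, x) = binormal_density \<rho> (x, y)"
  by (simp add: binormal_density_def algebra_simps)

lemma nn_integral_normal_times_cdf:
  assumes s: "s > 0"
  shows "(\<integral>\<^sup>+z. ennreal (normal_density m s z * std_normal_cdf (a * z + b)) \<partial>lborel) =
    ennreal (std_normal_cdf ((a * m + b) / sqrt (1 + a\<^sup>2 * s\<^sup>2)))"
proof (cases "a = 0")
  case True
  have "(\<integral>\<^sup>+z. ennreal (normal_density m s z * std_normal_cdf b) \<partial>lborel) =
    (\<integral>\<^sup>+z. ennreal (normal_density m s z) * ennreal (std_normal_cdf b) \<partial>lborel)"
    by (intro nn_integral_cong) (simp add: ennreal_mult' std_normal_cdf_bounds)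
  also have "\<dots> = (\<integral>\<^sup>+z. ennreal (normal_density m s z) \<partial>lborel) * ennreal (std_normal_cdf b)"
    by (rule nn_integral_multc) simp
  also have "(\<integral>\<^sup>+z. ennreal (normal_density m s z) \<partial>lborel) = 1"
    by (subst nn_integral_eq_integral) (use s in auto)
  finally show ?thesis using True by simp
next
  case a: False
  define S where "S = sqrt (1 + a\<^sup>2 * s\<^sup>2)"
  have S: "S > 0" unfolding S_def by (simp add: add_pos_nonneg)
  define c where "c = a * m + b"
  have inner: "ennreal (std_normal_cdf (a * z + b)) =
      (\<integral>\<^sup>+r. ennreal (std_normal_density (a * z + b - r)) * indicator {0..} r \<partial>lborel)" for z
    unfolding ennreal_std_normal_cdf
    by (subst nn_integral_real_affine[where c="-1" and t="a * z + b"])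
       (auto intro!: nn_integral_cong split: split_indicator)
  have conv: "(\<integral>\<^sup>+z. ennreal (normal_density m s z) * ennreal (std_normal_density (a * z + b - r)) \<partial>lborel)
     = ennreal (normal_density 0 S (r - c))" for r
  proof -
    have nd: "normal_density m s (m + 1/a * w) = \<bar>a\<bar> * normal_density 0 (\<bar>a\<bar> * s) w" for w
      using a s by (simp add: normal_density_def power_mult_distrib power_divide real_sqrt_mult field_simps)
    have "(\<integral>\<^sup>+z. ennreal (normal_density m s z) * ennreal (std_normal_density (a * z + b - r)) \<partial>lborel)
      = ennreal \<bar>1/a\<bar> * (\<integral>\<^sup>+w. ennreal (normal_density m s (m + 1/a * w)) *
           ennreal (std_normal_density (a * (m + 1/a * w) + b - r)) \<partial>lborel)"
      by (rule nn_integral_real_affine) (use a in auto)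
    also have "\<dots> = (\<integral>\<^sup>+w. ennreal \<bar>1/a\<bar> * (ennreal (normal_density m s (m + 1/a * w)) *
           ennreal (std_normal_density (a * (m + 1/a * w) + b - r))) \<partial>lborel)"
      by (rule nn_integral_cmult[symmetric]) measurable
    also have "\<dots> = (\<integral>\<^sup>+w. ennreal (normal_density 0 1 ((r - c) - w) * normal_density 0 (\<bar>a\<bar> * s) w) \<partial>lborel)"
    proof (rule nn_integral_cong)
      fix w
      have 1: "std_normal_density (a * (m + 1/a * w) + b - r) = std_normal_density ((r - c) - w)"
        using a unfolding c_def std_normal_density_def
        by (simp add: distrib_left) (simp add: power2_eq_square algebra_simps)
      show "ennreal \<bar>1/a\<bar> * (ennreal (normal_density m s (m + 1/a * w)) *
           ennreal (std_normal_density (a * (m + 1/a * w) + b - r))) =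
         ennreal (normal_density 0 1 ((r - c) - w) * normal_density 0 (\<bar>a\<bar> * s) w)"
        unfolding 1 nd using a s by (simp add: ennreal_mult'[symmetric] field_simps)
    qed
    also have "\<dots> = ennreal (normal_density 0 (sqrt (1\<^sup>2 + (\<bar>a\<bar> * s)\<^sup>2)) (r - c))"
      using conv_normal_density_zero_mean[of 1 "\<bar>a\<bar> * s"] a s by (auto dest: fun_cong)
    finally show ?thesis by (simp add: S_def power_mult_distrib)
  qed
  have "(\<integral>\<^sup>+z. ennreal (normal_density m s z * std_normal_cdf (a * z + b)) \<partial>lborel) =
    (\<integral>\<^sup>+z. \<integral>\<^sup>+r. ennreal (normal_density m s z) *
      (ennreal (std_normal_density (a * z + b - r)) * indicator {0..} r) \<partial>lborel \<partial>lborel)"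
    by (intro nn_integral_cong)
       (simp add: ennreal_mult' std_normal_cdf_bounds inner nn_integral_cmult)
  also have "\<dots> = (\<integral>\<^sup>+r. \<integral>\<^sup>+z. ennreal (normal_density m s z) *
      (ennreal (std_normal_density (a * z + b - r)) * indicator {0..} r) \<partial>lborel \<partial>lborel)"
    by (rule lborel_pair.Fubini') measurable
  also have "\<dots> = (\<integral>\<^sup>+r. ennreal (normal_density 0 S (r - c)) * indicator {0..} r \<partial>lborel)"
    unfolding conv[symmetric] by (intro nn_integral_cong) (simp add: nn_integral_multc flip: mult.assoc)
  also have "\<dots> = ennreal \<bar>-S\<bar> * (\<integral>\<^sup>+t. ennreal (normal_density 0 S ((c + -S * t) - c)) * indicator {0..} (c + -S * t) \<partial>lborel)"
    by (rule nn_integral_real_affine) (use S in auto)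
  also have "\<dots> = (\<integral>\<^sup>+t. ennreal \<bar>-S\<bar> * (ennreal (normal_density 0 S ((c + -S * t) - c)) * indicator {0..} (c + -S * t)) \<partial>lborel)"
    by (rule nn_integral_cmult[symmetric]) measurable
  also have "\<dots> = (\<integral>\<^sup>+t. ennreal (std_normal_density t) * indicator {..c / S} t \<partial>lborel)"
  proof (rule nn_integral_cong)
    fix t
    have "\<bar>-S\<bar> * normal_density 0 S ((c + -S * t) - c) = std_normal_density t"
      using S by (simp add: normal_density_def real_sqrt_mult power_mult_distrib field_simps)
    moreover have "indicator {0..} (c + -S * t) = (indicator {..c / S} t :: ennreal)"
      using S by (auto simp: field_simps split: split_indicator)
    ultimately show "ennreal \<bar>-S\<bar> * (ennreal (normal_density 0 S ((c + -S * t) - c)) * indicator {0..} (c + -S * t)) =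
       ennreal (std_normal_density t) * indicator {..c / S} t"
      by (simp add: ennreal_mult'[symmetric] flip: mult.assoc)
  qed
  finally show ?thesis unfolding S_def c_def ennreal_std_normal_cdf .
qed


lemma sn2_density_eq:
  assumes "-1 < \<rho>" "\<rho> < 1"
  shows "sn2_density (a1, a2) \<rho> (x, y) =
    2 * std_normal_density y * (normal_density (\<rho> * y) (sqrt (1 - \<rho>\<^sup>2)) x * std_normal_cdf (a1 * x + a2 * y))"
  by (simp add: sn2_density_def binormal_density_eq[OF assms] inner_prod_def)

lemma sn2_density_swap: "sn2_density (a1, a2) \<rho> (x, y) = sn2_density (a2, a1) \<rho> (y, x)"
  by (simp add: sn2_density_def binormal_density_swap inner_prod_def add.commute)

lemma sn2_lambda_swap: "sn2_lambda1 (a1, a2) \<rho> = sn2_lambda2 (a2, a1) \<rho>"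
  by (simp add: sn2_lambda1_def sn2_lambda2_def)

lemma nn_integral_sn2_density:
  assumes "-1 < \<rho>" "\<rho> < 1"
  shows "(\<integral>\<^sup>+x. ennreal (sn2_density (a1, a2) \<rho> (x, y)) \<partial>lborel) =
    ennreal (2 * std_normal_density y * std_normal_cdf (sn2_lambda2 (a1, a2) \<rho> * y))"
proof -
  have r: "1 - \<rho>\<^sup>2 > 0" using assms by (simp add: abs_square_less_1)
  have "(\<integral>\<^sup>+x. ennreal (sn2_density (a1, a2) \<rho> (x, y)) \<partial>lborel) =
     (\<integral>\<^sup>+x. ennreal (2 * std_normal_density y) *
        ennreal (normal_density (\<rho> * y) (sqrt (1 - \<rho>\<^sup>2)) x * std_normal_cdf (a1 * x + a2 * y)) \<partial>lborel)"
    unfolding sn2_density_eq[OF assms] by (intro nn_integral_cong ennreal_mult') simp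
  also have "\<dots> = ennreal (2 * std_normal_density y) * ennreal (std_normal_cdf
       ((a1 * (\<rho> * y) + a2 * y) / sqrt (1 + a1\<^sup>2 * (sqrt (1 - \<rho>\<^sup>2))\<^sup>2)))"
    by (subst nn_integral_cmult, measurable, subst nn_integral_normal_times_cdf) (use r in auto)
  also have "(a1 * (\<rho> * y) + a2 * y) / sqrt (1 + a1\<^sup>2 * (sqrt (1 - \<rho>\<^sup>2))\<^sup>2) = sn2_lambda2 (a1, a2) \<rho> * y"
    using r by (simp add: sn2_lambda2_def algebra_simps add_divide_distrib)
  finally show ?thesis by (simp add: ennreal_mult')
qed

lemma integral_sn2_density:
  assumes "-1 < \<rho>" "\<rho> < 1"
  shows "(LINT x|lborel. sn2_density (a1, a2) \<rho> (x, y)) =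
    2 * std_normal_density y * std_normal_cdf (sn2_lambda2 (a1, a2) \<rho> * y)"
proof -
  have "(LINT x|lborel. sn2_density (a1, a2) \<rho> (x, y)) =
     enn2real (\<integral>\<^sup>+x. ennreal (sn2_density (a1, a2) \<rho> (x, y)) \<partial>lborel)"
    by (rule integral_eq_nn_integral) (auto simp: sn2_density_eq[OF assms] std_normal_cdf_bounds)
  then show ?thesis
    by (simp add: nn_integral_sn2_density[OF assms] std_normal_cdf_bounds)
qed

lemma cond_cdf_sn2:
  assumes "-1 < \<rho>" "\<rho> < 1"
  shows "cond_cdf (sn2_density (a1, a2) \<rho>) x y =
    (LINT z:{..x}|lborel. 1 / sqrt (2 * pi * (1 - \<rho>\<^sup>2)) * exp (- (z - \<rho> * y)\<^sup>2 / (2 * (1 - \<rho>\<^sup>2)))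
       * (std_normal_cdf (a1 * z + a2 * y) / std_normal_cdf (sn2_lambda2 (a1, a2) \<rho> * y)))"
proof -
  have r: "1 - \<rho>\<^sup>2 > 0" using assms by (simp add: abs_square_less_1)
  have p: "std_normal_density y > 0" by (simp add: normal_density_pos)
  have nd: "1 / sqrt (2 * pi * (1 - \<rho>\<^sup>2)) * exp (- (z - \<rho> * y)\<^sup>2 / (2 * (1 - \<rho>\<^sup>2)))
     = normal_density (\<rho> * y) (sqrt (1 - \<rho>\<^sup>2)) z" for z
    using r by (simp add: normal_density_def)
  show ?thesis
    unfolding cond_cdf_def integral_sn2_density[OF assms] nd
    unfolding sn2_density_eq[OF assms]
      times_divide_eq_right set_integral_divide_zero set_integral_mult_right
    using p by simp
qed

definition sn_dist :: "real \<Rightarrow> real measure" where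
  "sn_dist l = density lborel (\<lambda>x. ennreal (2 * std_normal_density x * std_normal_cdf (l * x)))"

lemma skew_normal2_marginals:
  assumes "prob_space M" "-1 < \<rho>" "\<rho> < 1" "skew_normal2 M Z (a1, a2) \<rho>"
  shows "distr M borel (\<lambda>\<omega>. fst (Z \<omega>)) = sn_dist (sn2_lambda1 (a1, a2) \<rho>)"
    and "distr M borel (\<lambda>\<omega>. snd (Z \<omega>)) = sn_dist (sn2_lambda2 (a1, a2) \<rho>)"
proof -
  interpret prob_space M by fact
  have sf: "sigma_finite_measure (lborel :: real measure)" by standard
  have d: "distributed M (lborel \<Otimes>\<^sub>M lborel) (\<lambda>\<omega>. (fst (Z \<omega>), snd (Z \<omega>)))
      (\<lambda>z. ennreal (sn2_density (a1, a2) \<rho> z))"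
    using assms(4) by (simp add: skew_normal2_def lborel_prod)
  have 1: "(\<integral>\<^sup>+y. ennreal (sn2_density (a1, a2) \<rho> (x, y)) \<partial>lborel) =
     ennreal (2 * std_normal_density x * std_normal_cdf (sn2_lambda1 (a1, a2) \<rho> * x))" for x
    unfolding sn2_density_swap[of a1 a2] sn2_lambda_swap by (rule nn_integral_sn2_density) fact+
  have "distr M lborel (\<lambda>\<omega>. fst (Z \<omega>)) = sn_dist (sn2_lambda1 (a1, a2) \<rho>)"
    using distr_marginal1[OF sf sf d] by (simp add: distributed_def sn_dist_def 1)
  then show "distr M borel (\<lambda>\<omega>. fst (Z \<omega>)) = sn_dist (sn2_lambda1 (a1, a2) \<rho>)"
    by (simp cong: distr_cong)
  have "distr M lborel (\<lambda>\<omega>. snd (Z \<omega>)) = sn_dist (sn2_lambda2 (a1, a2) \<rho>)"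
    using distr_marginal2[OF sf sf d]
    by (simp add: distributed_def sn_dist_def nn_integral_sn2_density[OF assms(2,3)])
  then show "distr M borel (\<lambda>\<omega>. snd (Z \<omega>)) = sn_dist (sn2_lambda2 (a1, a2) \<rho>)"
    by (simp cong: distr_cong)
qed

lemma std_normal_cdf_mono: "x \<le> y \<Longrightarrow> std_normal_cdf x \<le> std_normal_cdf y"
proof -
  interpret N: prob_space std_normal_distribution by (rule prob_space_normal_density) simp
  interpret R: finite_borel_measure std_normal_distribution by standard auto
  show "x \<le> y \<Longrightarrow> std_normal_cdf x \<le> std_normal_cdf y" by (rule R.cdf_nondecreasing)
qed

lemma std_normal_density_mono: "x \<le> y \<Longrightarrow> y \<le> 0 \<Longrightarrow> std_normal_density x \<le> std_normal_density y"
  by (auto simp: std_normal_density_def intro!: divide_right_mono power_mono_even abs_le_square_iff[THEN iffD1])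

lemma std_normal_cdf_upper:
  assumes "x \<le> 0"
  shows "std_normal_cdf x \<le> exp (- x\<^sup>2 / 2)"
proof -
  have "ennreal (std_normal_cdf x) = (\<integral>\<^sup>+t. ennreal (std_normal_density (x + t)) * indicator {..x} (x + t) \<partial>lborel)"
    unfolding ennreal_std_normal_cdf
    by (subst nn_integral_real_affine[where c=1 and t=x]) auto
  also have "\<dots> \<le> (\<integral>\<^sup>+t. ennreal (exp (- x\<^sup>2 / 2)) * ennreal (std_normal_density t) \<partial>lborel)"
  proof (rule nn_integral_mono)
    fix t
    show "ennreal (std_normal_density (x + t)) * indicator {..x} (x + t)
       \<le> ennreal (exp (- x\<^sup>2 / 2)) * ennreal (std_normal_density t)"
    proof (cases "t \<le> 0")
      case True
      have "x * t \<ge> 0" using True assms by (simp add: mult_nonpos_nonpos)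
      then have "exp (- (x + t)\<^sup>2 / 2) \<le> exp (- x\<^sup>2 / 2 + - t\<^sup>2 / 2)"
        unfolding exp_le_cancel_iff by (simp add: power2_eq_square field_simps)
      then have "std_normal_density (x + t) \<le> exp (- x\<^sup>2 / 2) * std_normal_density t"
        unfolding std_normal_density_def exp_add by (simp add: field_simps)
      then show ?thesis using True by (simp add: ennreal_mult'[symmetric] ennreal_leI)
    qed simp
  qed
  also have "\<dots> = ennreal (exp (- x\<^sup>2 / 2)) * (\<integral>\<^sup>+t. ennreal (std_normal_density t) \<partial>lborel)"
    by (rule nn_integral_cmult) simp
  also have "(\<integral>\<^sup>+t. ennreal (std_normal_density t) \<partial>lborel) = 1"
    by (subst nn_integral_eq_integral) auto
  finally show ?thesis by (simp add: ennreal_le_iff)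
qed

lemma std_normal_cdf_lower:
  assumes "x \<le> 0"
  shows "std_normal_density (x - 1) \<le> std_normal_cdf x"
proof -
  have "ennreal (std_normal_density (x - 1)) =
      (\<integral>\<^sup>+t. ennreal (std_normal_density (x - 1)) * indicator {x - 1..x} t \<partial>lborel)"
    by (simp add: nn_integral_cmult_indicator)
  also have "\<dots> \<le> (\<integral>\<^sup>+t. ennreal (std_normal_density t) * indicator {..x} t \<partial>lborel)"
    by (rule nn_integral_mono)
       (use assms in \<open>auto split: split_indicator intro!: ennreal_leI std_normal_density_mono\<close>)
  finally show ?thesis by (simp add: ennreal_std_normal_cdf[symmetric] std_normal_cdf_bounds)
qed


lemma std_normal_cdf_pos: "0 < std_normal_cdf x"
proof (cases "x \<le> 0")
  case True
  have "0 < std_normal_density (x - 1)" by (simp add: normal_density_pos)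
  with std_normal_cdf_lower[OF True] show ?thesis by linarith
next
  case False
  have "0 < std_normal_density (0 - 1)" by (simp add: normal_density_pos)
  with std_normal_cdf_lower[of 0] std_normal_cdf_mono[of 0 x] False show ?thesis by linarith
qed

lemma prob_space_sn_dist: "prob_space (sn_dist l)"
proof
  have "(\<integral>\<^sup>+x. ennreal (2 * std_normal_density x * std_normal_cdf (l * x)) \<partial>lborel) =
    (\<integral>\<^sup>+x. ennreal 2 * ennreal (normal_density 0 1 x * std_normal_cdf (l * x + 0)) \<partial>lborel)"
    by (intro nn_integral_cong) (simp add: ennreal_mult' std_normal_cdf_bounds mult.assoc)
  also have "\<dots> = ennreal 2 * ennreal (std_normal_cdf 0)"
    by (subst nn_integral_cmult, measurable, subst nn_integral_normal_times_cdf) auto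
  finally have e: "emeasure (sn_dist l) (space (sn_dist l)) = ennreal 2 * ennreal (std_normal_cdf 0)"
    by (simp add: sn_dist_def emeasure_density)
  have "ennreal (std_normal_cdf 0) + ennreal (std_normal_cdf 0) = 1"
  proof -
    have 1: "ennreal (std_normal_cdf 0) = (\<integral>\<^sup>+t. ennreal (std_normal_density t) * indicator {0..} t \<partial>lborel)"
      unfolding ennreal_std_normal_cdf
      by (subst nn_integral_real_affine[where c="-1" and t=0])
         (auto intro!: nn_integral_cong simp: normal_density_def split: split_indicator)
    have "ennreal (std_normal_cdf 0) + ennreal (std_normal_cdf 0) =
      (\<integral>\<^sup>+t. ennreal (std_normal_density t) * indicator {..0} t \<partial>lborel)
       + (\<integral>\<^sup>+t. ennreal (std_normal_density t) * indicator {0..} t \<partial>lborel)"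
      by (simp add: 1[symmetric] ennreal_std_normal_cdf[symmetric])
    also have "\<dots> = (\<integral>\<^sup>+t. ennreal (std_normal_density t) * indicator {..0} t
       + ennreal (std_normal_density t) * indicator {0..} t \<partial>lborel)"
      by (rule nn_integral_add[symmetric]) auto
    also have "\<dots> = (\<integral>\<^sup>+t. ennreal (std_normal_density t) \<partial>lborel)"
    proof (rule nn_integral_cong_AE)
      have "AE t in lborel. t \<noteq> (0::real)" by (rule AE_lborel_singleton)
      then show "AE t in lborel. ennreal (std_normal_density t) * indicator {..0} t
         + ennreal (std_normal_density t) * indicator {0..} t = ennreal (std_normal_density t)"
        by eventually_elim (auto split: split_indicator)
    qed
    also have "\<dots> = 1" by (subst nn_integral_eq_integral) auto
    finally show ?thesis .
  qed
  then show "emeasure (sn_dist l) (space (sn_dist l)) = 1"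
    unfolding e by (simp add: mult_2)
qed

lemma sn_dist_cdf:
  "ennreal (cdf (sn_dist l) x) =
     (\<integral>\<^sup>+t. ennreal (2 * std_normal_density t * std_normal_cdf (l * t)) * indicator {..x} t \<partial>lborel)"
proof -
  interpret prob_space "sn_dist l" by (rule prob_space_sn_dist)
  have "ennreal (cdf (sn_dist l) x) = emeasure (sn_dist l) {..x}"
    by (simp add: cdf_def emeasure_eq_measure)
  also have "\<dots> = (\<integral>\<^sup>+t. ennreal (2 * std_normal_density t * std_normal_cdf (l * t)) * indicator {..x} t \<partial>lborel)"
    unfolding sn_dist_def by (rule emeasure_density) auto
  finally show ?thesis .
qed

lemma real_distribution_sn_dist: "real_distribution (sn_dist l)"
  using prob_space_sn_dist[of l]
  by (auto simp: real_distribution_def real_distribution_axioms_def sn_dist_def)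

lemma sn_dist_cdf_upper:
  assumes "x \<le> 0"
  shows "cdf (sn_dist l) x \<le> 2 * exp (- (1 + (max 0 l)\<^sup>2) * x\<^sup>2 / 2)"
proof -
  have l: "std_normal_cdf (l * t) \<le> exp (- (max 0 l)\<^sup>2 * x\<^sup>2 / 2)" if "t \<le> x" for t
  proof (cases "l > 0")
    case True
    have "std_normal_cdf (l * t) \<le> std_normal_cdf (l * x)"
      using True that by (intro std_normal_cdf_mono) simp
    also have "\<dots> \<le> exp (- (l * x)\<^sup>2 / 2)"
      using True assms by (intro std_normal_cdf_upper) (simp add: mult_nonneg_nonpos)
    finally show ?thesis using True by (simp add: power_mult_distrib max_def)
  qed (use std_normal_cdf_bounds in \<open>simp add: max_def\<close>)
  have "ennreal (cdf (sn_dist l) x) \<le> (\<integral>\<^sup>+t. ennreal (2 * exp (- (max 0 l)\<^sup>2 * x\<^sup>2 / 2)) *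
      (ennreal (std_normal_density t) * indicator {..x} t) \<partial>lborel)"
    unfolding sn_dist_cdf
  proof (rule nn_integral_mono)
    fix t
    show "ennreal (2 * std_normal_density t * std_normal_cdf (l * t)) * indicator {..x} t
      \<le> ennreal (2 * exp (- (max 0 l)\<^sup>2 * x\<^sup>2 / 2)) * (ennreal (std_normal_density t) * indicator {..x} t)"
    proof (cases "t \<le> x")
      case True
      have "2 * std_normal_density t * std_normal_cdf (l * t) \<le> 2 * std_normal_density t * exp (- (max 0 l)\<^sup>2 * x\<^sup>2 / 2)"
        by (rule mult_left_mono[OF l[OF True]]) simp
      then show ?thesis using True by (simp add: ennreal_mult'[symmetric] ennreal_leI mult_ac)
    qed simp
  qed
  also have "\<dots> = ennreal (2 * exp (- (max 0 l)\<^sup>2 * x\<^sup>2 / 2)) * ennreal (std_normal_cdf x)"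
    unfolding ennreal_std_normal_cdf by (rule nn_integral_cmult) measurable
  also have "\<dots> \<le> ennreal (2 * exp (- (max 0 l)\<^sup>2 * x\<^sup>2 / 2)) * ennreal (exp (- x\<^sup>2 / 2))"
    by (intro mult_left_mono ennreal_leI std_normal_cdf_upper assms) simp
  also have "\<dots> = ennreal (2 * exp (- (1 + (max 0 l)\<^sup>2) * x\<^sup>2 / 2))"
    by (simp add: ennreal_mult'[symmetric] mult_exp_exp algebra_simps add_divide_distrib)
  finally show ?thesis by (simp add: ennreal_le_iff)
qed

lemma sn_dist_cdf_lower:
  assumes "x \<le> 0"
  shows "2 * std_normal_density (x - 1) * std_normal_density (max 0 l * (x - 1) - 1) \<le> cdf (sn_dist l) x"
proof -
  interpret prob_space "sn_dist l" by (rule prob_space_sn_dist)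
  have l: "std_normal_density (max 0 l * (x - 1) - 1) \<le> std_normal_cdf (l * t)" if "t \<in> {x - 1..x}" for t
  proof -
    have "std_normal_density (max 0 l * (x - 1) - 1) \<le> std_normal_cdf (max 0 l * (x - 1))"
      using assms by (intro std_normal_cdf_lower) (simp add: mult_nonneg_nonpos)
    also have "max 0 l * (x - 1) \<le> l * t"
      using that assms by (cases "l > 0") (auto simp: max_def mult_nonpos_nonpos)
    then have "std_normal_cdf (max 0 l * (x - 1)) \<le> std_normal_cdf (l * t)" by (rule std_normal_cdf_mono)
    finally show ?thesis .
  qed
  have "ennreal (2 * std_normal_density (x - 1) * std_normal_density (max 0 l * (x - 1) - 1)) =
      (\<integral>\<^sup>+t. ennreal (2 * std_normal_density (x - 1) * std_normal_density (max 0 l * (x - 1) - 1)) * indicator {x - 1..x} t \<partial>lborel)"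
    by (simp add: nn_integral_cmult_indicator)
  also have "\<dots> \<le> ennreal (cdf (sn_dist l) x)"
    unfolding sn_dist_cdf
    by (rule nn_integral_mono)
       (use assms l in \<open>auto split: split_indicator intro!: ennreal_leI mult_mono std_normal_density_mono\<close>)
  finally show ?thesis by (simp add: cdf_def)
qed

lemma sn_dist_cdf_strict_mono:
  assumes "x < y"
  shows "cdf (sn_dist l) x < cdf (sn_dist l) y"
proof -
  interpret real_distribution "sn_dist l" by (rule real_distribution_sn_dist)
  have "measure (sn_dist l) {x<..y} \<noteq> 0"
  proof
    assume "measure (sn_dist l) {x<..y} = 0"
    then have "emeasure (sn_dist l) {x<..y} = 0" by (simp add: emeasure_eq_measure)
    then have "(\<integral>\<^sup>+t. ennreal (2 * std_normal_density t * std_normal_cdf (l * t)) * indicator {x<..y} t \<partial>lborel) = 0"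
      unfolding sn_dist_def by (subst (asm) emeasure_density) auto
    then have "AE t in lborel. ennreal (2 * std_normal_density t * std_normal_cdf (l * t)) * indicator {x<..y} t = 0"
      by (subst (asm) nn_integral_0_iff_AE) auto
    moreover have "ennreal (2 * std_normal_density t * std_normal_cdf (l * t)) \<noteq> 0" for t
      using normal_density_pos[of 1 0 t] std_normal_cdf_pos[of "l * t"]
      by (simp add: ennreal_eq_0_iff not_le)
    ultimately have "AE t in lborel. t \<notin> {x<..y}"
      by (auto elim!: eventually_mono split: split_indicator_asm simp: not_le)
    then have "emeasure lborel {x<..y} = 0"
      by (subst (asm) AE_iff_measurable[where N="{x<..y}"]) auto
    then show False using assms by simp
  qed
  then have "measure (sn_dist l) {x<..y} > 0" by (simp add: zero_less_measure_iff)
  then show ?thesis using cdf_diff_eq[OF assms] by simp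
qed

lemma sn_dist_cdf_continuous: "isCont (cdf (sn_dist l)) x"
proof -
  interpret real_distribution "sn_dist l" by (rule real_distribution_sn_dist)
  have "emeasure (sn_dist l) {x} = 0"
  proof -
    have "AE t in lborel. t \<in> {x} \<longrightarrow> ennreal (2 * std_normal_density t * std_normal_cdf (l * t)) = 0"
      using AE_lborel_singleton[of x] by eventually_elim auto
    then show ?thesis
      unfolding sn_dist_def by (subst emeasure_density) (auto simp: nn_integral_0_iff_AE elim!: eventually_mono split: split_indicator)
  qed
  then show ?thesis by (simp add: isCont_cdf measure_def)
qed

lemma cdf_inv_cdf_sn_dist:
  assumes "0 < u" "u < 1"
  shows "cdf (sn_dist l) (inv (cdf (sn_dist l)) u) = u"
proof -
  interpret real_distribution "sn_dist l" by (rule real_distribution_sn_dist)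
  have "eventually (\<lambda>x. cdf (sn_dist l) x < u) at_bot"
    using order_tendstoD(2)[OF cdf_lim_at_bot assms(1)] .
  then obtain a where a: "cdf (sn_dist l) a < u" by (auto simp: eventually_at_bot_linorder)
  have "eventually (\<lambda>x. u < cdf (sn_dist l) x) at_top"
    using order_tendstoD(1)[OF cdf_lim_at_top_prob assms(2)] .
  then obtain b where b: "u < cdf (sn_dist l) b" by (auto simp: eventually_at_top_linorder)
  have "a \<le> b" using a b cdf_nondecreasing[of b a] by linarith
  then obtain x where "cdf (sn_dist l) x = u"
    using IVT[of "cdf (sn_dist l)" a u b] a b sn_dist_cdf_continuous by auto
  then show ?thesis by (auto intro: f_inv_into_f)
qed

lemma inv_cdf_sn_dist_at_bot: "filterlim (inv (cdf (sn_dist l))) at_bot (at_right 0)"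
  unfolding filterlim_at_bot
proof
  fix c
  interpret real_distribution "sn_dist l" by (rule real_distribution_sn_dist)
  have "0 < cdf (sn_dist l) c"
    using sn_dist_cdf_strict_mono[of "c - 1" c l] cdf_nonneg[of "c - 1"] by simp
  then have "eventually (\<lambda>u. u \<in> {0<..<min 1 (cdf (sn_dist l) c)}) (at_right 0)"
    by (intro eventually_at_right_real) simp
  then show "eventually (\<lambda>u. inv (cdf (sn_dist l)) u \<le> c) (at_right 0)"
  proof eventually_elim
    case (elim u)
    then have "cdf (sn_dist l) (inv (cdf (sn_dist l)) u) < cdf (sn_dist l) c"
      by (simp add: cdf_inv_cdf_sn_dist)
    then show ?case using cdf_nondecreasing[of c "inv (cdf (sn_dist l)) u"] by force
  qed
qed

lemma ln_sn_dist_cdf: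
  "((\<lambda>x. ln (cdf (sn_dist l) x) / x\<^sup>2) \<longlongrightarrow> - (1 + (max 0 l)\<^sup>2) / 2) at_bot"
proof -
  define m where "m = max 0 l"
  have e: "eventually (\<lambda>x::real. x < 0) at_bot" by (rule eventually_gt_at_bot)
  have lo: "((\<lambda>x::real. (ln 2 - ln (2 * pi) - ((x - 1)\<^sup>2 + (m * (x - 1) - 1)\<^sup>2) / 2) / x\<^sup>2)
      \<longlongrightarrow> - (1 + m\<^sup>2) / 2) at_bot"
  proof -
    have i: "((\<lambda>x::real. inverse x) \<longlongrightarrow> 0) at_bot" by (rule tendsto_mono[OF at_bot_le_at_infinity tendsto_inverse_0])
    have "((\<lambda>x::real. (ln 2 - ln (2 * pi)) * (inverse x)\<^sup>2 -
       ((1 - inverse x)\<^sup>2 + (m * (1 - inverse x) - inverse x)\<^sup>2) / 2) \<longlongrightarrow>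
       (ln 2 - ln (2 * pi)) * 0\<^sup>2 - ((1 - 0)\<^sup>2 + (m * (1 - 0) - 0)\<^sup>2) / 2) at_bot"
      by (intro tendsto_intros i) simp_all
    then have "((\<lambda>x::real. (ln 2 - ln (2 * pi)) * (inverse x)\<^sup>2 -
       ((1 - inverse x)\<^sup>2 + (m * (1 - inverse x) - inverse x)\<^sup>2) / 2) \<longlongrightarrow> - (1 + m\<^sup>2) / 2) at_bot"
      by (simp add: minus_divide_left)
    moreover have "eventually (\<lambda>x. (ln 2 - ln (2 * pi)) * (inverse x)\<^sup>2 -
       ((1 - inverse x)\<^sup>2 + (m * (1 - inverse x) - inverse x)\<^sup>2) / 2 =
       (ln 2 - ln (2 * pi) - ((x - 1)\<^sup>2 + (m * (x - 1) - 1)\<^sup>2) / 2) / x\<^sup>2) at_bot"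
      using e
    proof eventually_elim
      case (elim x)
      have 1: "1 - inverse x = (x - 1) / x" using elim by (simp add: field_simps)
      have 2: "m * (1 - inverse x) - inverse x = (m * (x - 1) - 1) / x"
        using elim by (simp add: field_simps)
      have 3: "K * (inverse x)\<^sup>2 - ((p / x)\<^sup>2 + (q / x)\<^sup>2) / 2 = (K - (p\<^sup>2 + q\<^sup>2) / 2) / x\<^sup>2" for K p q
        using elim by (simp add: power_divide power_inverse field_simps)
      show ?case unfolding 2 unfolding 1 by (rule 3)
    qed
    ultimately show ?thesis by (rule Lim_transform_eventually)
  qed
  have up: "((\<lambda>x::real. (ln 2 - (1 + m\<^sup>2) * x\<^sup>2 / 2) / x\<^sup>2) \<longlongrightarrow> - (1 + m\<^sup>2) / 2) at_bot"
  proof -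
    have i: "((\<lambda>x::real. inverse x) \<longlongrightarrow> 0) at_bot" by (rule tendsto_mono[OF at_bot_le_at_infinity tendsto_inverse_0])
    have "((\<lambda>x::real. ln 2 * (inverse x)\<^sup>2 - (1 + m\<^sup>2) / 2) \<longlongrightarrow> ln 2 * 0\<^sup>2 - (1 + m\<^sup>2) / 2) at_bot"
      by (intro tendsto_intros i)
    then have "((\<lambda>x::real. ln 2 * (inverse x)\<^sup>2 - (1 + m\<^sup>2) / 2) \<longlongrightarrow> - (1 + m\<^sup>2) / 2) at_bot"
      by (simp add: minus_divide_left)
    moreover have "eventually (\<lambda>x. ln 2 * (inverse x)\<^sup>2 - (1 + m\<^sup>2) / 2 =
       (ln 2 - (1 + m\<^sup>2) * x\<^sup>2 / 2) / x\<^sup>2) at_bot"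
      using e by eventually_elim (simp add: field_simps)
    ultimately show ?thesis by (rule Lim_transform_eventually)
  qed
  have two_densities: "2 * std_normal_density a * std_normal_density b =
      exp (ln 2 - ln (2 * pi) - (a\<^sup>2 + b\<^sup>2) / 2)" for a b
  proof -
    have e: "ln 2 - ln (2 * pi) - (a\<^sup>2 + b\<^sup>2) / 2 = (ln 2 - ln (2 * pi)) + (- a\<^sup>2 / 2 + - b\<^sup>2 / 2)"
      by (simp add: add_divide_distrib)
    have "exp (ln 2 - ln (2 * pi)) = 2 / (2 * pi)" unfolding exp_diff by simp
    moreover have "sqrt (2 * pi) * sqrt (2 * pi) = 2 * pi" by (subst real_sqrt_mult_self) simp
    ultimately show ?thesis unfolding e exp_add std_normal_density_def
      by (simp add: field_simps del: real_sqrt_mult)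
  qed
  have pos: "0 < cdf (sn_dist l) x" for x
  proof -
    interpret real_distribution "sn_dist l" by (rule real_distribution_sn_dist)
    show ?thesis using sn_dist_cdf_strict_mono[of "x - 1" x l] cdf_nonneg[of "x - 1"] by simp
  qed
  show ?thesis unfolding m_def[symmetric]
  proof (rule tendsto_sandwich[OF _ _ lo up])
    show "eventually (\<lambda>x. (ln 2 - ln (2 * pi) - ((x - 1)\<^sup>2 + (m * (x - 1) - 1)\<^sup>2) / 2) / x\<^sup>2
       \<le> ln (cdf (sn_dist l) x) / x\<^sup>2) at_bot"
      using e
    proof eventually_elim
      case (elim x)
      have "2 * std_normal_density (x - 1) * std_normal_density (m * (x - 1) - 1) =
         exp (ln 2 - ln (2 * pi) - ((x - 1)\<^sup>2 + (m * (x - 1) - 1)\<^sup>2) / 2)"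
        by (rule two_densities)
      then have "exp (ln 2 - ln (2 * pi) - ((x - 1)\<^sup>2 + (m * (x - 1) - 1)\<^sup>2) / 2) \<le> cdf (sn_dist l) x"
        using sn_dist_cdf_lower[of x l] elim by (simp add: m_def)
      then show ?case by (intro divide_right_mono) (simp_all add: pos ln_ge_iff)
    qed
    show "eventually (\<lambda>x. ln (cdf (sn_dist l) x) / x\<^sup>2 \<le> (ln 2 - (1 + m\<^sup>2) * x\<^sup>2 / 2) / x\<^sup>2) at_bot"
      using e
    proof eventually_elim
      case (elim x)
      have "ln (cdf (sn_dist l) x) \<le> ln (2 * exp (- (1 + m\<^sup>2) * x\<^sup>2 / 2))"
        using sn_dist_cdf_upper[of x l] elim pos[of x] by (intro ln_mono) (simp_all add: m_def)
      also have "\<dots> = ln 2 - (1 + m\<^sup>2) * x\<^sup>2 / 2"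
        by (subst ln_mult) (simp_all add: algebra_simps add_divide_distrib diff_divide_distrib)
      finally show ?case by (intro divide_right_mono) simp_all
    qed
  qed
qed

lemma sn_quantile_ratio:
  "((\<lambda>u. inv (cdf (sn_dist l)) u / inv (cdf (sn_dist l')) u) \<longlongrightarrow>
     sqrt ((1 + (max 0 l')\<^sup>2) / (1 + (max 0 l)\<^sup>2))) (at_right 0)"
proof -
  have k: "0 < 1 + (max 0 l)\<^sup>2" for l :: real by (simp add: add_pos_nonneg)
  let ?q = "\<lambda>l. inv (cdf (sn_dist l))"
  have ev: "eventually (\<lambda>u::real. u \<in> {0<..<1}) (at_right 0)" by (intro eventually_at_right_real) simp
  have neg: "eventually (\<lambda>u. ?q l u < 0) (at_right 0)" for l
    using inv_cdf_sn_dist_at_bot[of l] unfolding filterlim_at_bot_dense by blast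
  have L: "((\<lambda>u. ln u / (?q l u)\<^sup>2) \<longlongrightarrow> - (1 + (max 0 l)\<^sup>2) / 2) (at_right 0)" for l
  proof (rule Lim_transform_eventually)
    show "((\<lambda>u. ln (cdf (sn_dist l) (?q l u)) / (?q l u)\<^sup>2) \<longlongrightarrow> - (1 + (max 0 l)\<^sup>2) / 2) (at_right 0)"
      by (rule filterlim_compose[OF ln_sn_dist_cdf inv_cdf_sn_dist_at_bot])
    show "eventually (\<lambda>u. ln (cdf (sn_dist l) (?q l u)) / (?q l u)\<^sup>2 = ln u / (?q l u)\<^sup>2) (at_right 0)"
      using ev by eventually_elim (simp add: cdf_inv_cdf_sn_dist)
  qed
  have "((\<lambda>u. (ln u / (?q l' u)\<^sup>2) / (ln u / (?q l u)\<^sup>2)) \<longlongrightarrow>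
     (- (1 + (max 0 l')\<^sup>2) / 2) / (- (1 + (max 0 l)\<^sup>2) / 2)) (at_right 0)"
    by (rule tendsto_divide[OF L L]) (use k[of l] in simp)
  then have "((\<lambda>u. sqrt ((ln u / (?q l' u)\<^sup>2) / (ln u / (?q l u)\<^sup>2))) \<longlongrightarrow>
     sqrt ((- (1 + (max 0 l')\<^sup>2) / 2) / (- (1 + (max 0 l)\<^sup>2) / 2))) (at_right 0)"
    by (rule tendsto_real_sqrt)
  also have "(- (1 + (max 0 l')\<^sup>2) / 2) / (- (1 + (max 0 l)\<^sup>2) / 2) = (1 + (max 0 l')\<^sup>2) / (1 + (max 0 l)\<^sup>2)"
    using k[of l] by (simp add: field_simps)
  finally show ?thesis
  proof (rule Lim_transform_eventually)
    show "eventually (\<lambda>u. sqrt ((ln u / (?q l' u)\<^sup>2) / (ln u / (?q l u)\<^sup>2)) = ?q l u / ?q l' u) (at_right 0)"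
      using ev neg[of l] neg[of l']
    proof eventually_elim
      case (elim u)
      then have "(ln u / (?q l' u)\<^sup>2) / (ln u / (?q l u)\<^sup>2) = (?q l u / ?q l' u)\<^sup>2"
        by (simp add: power_divide field_simps)
      then show ?case using elim by (simp add: divide_nonpos_nonpos)
    qed
  qed
qed

lemma skew_normal2_quantile:
  assumes "prob_space M" "-1 < \<rho>" "\<rho> < 1" "skew_normal2 M Z (a1, a2) \<rho>" "0 < u" "u < 1"
  shows "cdf (distr M borel (\<lambda>\<omega>. fst (Z \<omega>))) (quantile1 M Z u) = u"
    and "cdf (distr M borel (\<lambda>\<omega>. snd (Z \<omega>))) (quantile2 M Z u) = u"
  using assms(5,6) by (simp_all add: quantile_def skew_normal2_marginals[OF assms(1-4)] cdf_inv_cdf_sn_dist)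

lemma sn2_gamma1_tendsto:
  assumes "prob_space M" "-1 < \<rho>" "\<rho> < 1" "skew_normal2 M Z (a1, a2) \<rho>"
  shows "((\<lambda>u. quantile1 M Z u / quantile2 M Z u) \<longlongrightarrow> sn2_gamma1 M Z) (at_right 0)"
    and "sn2_gamma1 M Z =
      (let l1 = sn2_lambda1 (a1, a2) \<rho>; l2 = sn2_lambda2 (a1, a2) \<rho> in
       if l1 > 0 \<and> l2 > 0 then sqrt ((1 + l2\<^sup>2) / (1 + l1\<^sup>2))
       else if l1 \<le> 0 \<and> l2 > 0 then sqrt (1 + l2\<^sup>2)
       else if l1 > 0 \<and> l2 \<le> 0 then 1 / sqrt (1 + l1\<^sup>2)
       else 1)"
proof -
  define l1 where "l1 = sn2_lambda1 (a1, a2) \<rho>"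
  define l2 where "l2 = sn2_lambda2 (a1, a2) \<rho>"
  have t: "((\<lambda>u. quantile1 M Z u / quantile2 M Z u) \<longlongrightarrow>
     sqrt ((1 + (max 0 l2)\<^sup>2) / (1 + (max 0 l1)\<^sup>2))) (at_right 0)"
    unfolding quantile_def skew_normal2_marginals[OF assms] l1_def l2_def by (rule sn_quantile_ratio)
  then have g: "sn2_gamma1 M Z = sqrt ((1 + (max 0 l2)\<^sup>2) / (1 + (max 0 l1)\<^sup>2))"
    unfolding sn2_gamma1_def by (intro tendsto_Lim) (auto simp: trivial_limit_at_right_real)
  show "((\<lambda>u. quantile1 M Z u / quantile2 M Z u) \<longlongrightarrow> sn2_gamma1 M Z) (at_right 0)"
    using t g by simp
  show "sn2_gamma1 M Z =
      (let l1 = sn2_lambda1 (a1, a2) \<rho>; l2 = sn2_lambda2 (a1, a2) \<rho> in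
       if l1 > 0 \<and> l2 > 0 then sqrt ((1 + l2\<^sup>2) / (1 + l1\<^sup>2))
       else if l1 \<le> 0 \<and> l2 > 0 then sqrt (1 + l2\<^sup>2)
       else if l1 > 0 \<and> l2 \<le> 0 then 1 / sqrt (1 + l1\<^sup>2)
       else 1)"
    unfolding g Let_def l1_def[symmetric] l2_def[symmetric]
    by (auto simp: max_def real_sqrt_divide)
qed

end

theory Submission imports Defs "HOL-Real_Asymp.Real_Asymp" begin

text \<open>
  Substituting \<open>z = x - t\<close> turns the conditional probability into
  \<open>\<integral>\<^sub>0\<^sup>\<infinity> exp (- (A - t)\<^sup>2 / (2v)) \<Phi>(B - \<alpha>\<^sub>1 t) dt\<close>, up to a factor, where \<open>v = 1 - \<rho>\<^sup>2\<close>.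
  The reversed hazard rate \<open>r = \<phi> / \<Phi>\<close> satisfies \<open>-1 \<le> r' \<le> 0\<close>, so a second order Taylor expansion of
  \<open>ln \<Phi>\<close> at \<open>B\<close> squeezes the integrand between \<open>exp (ct - Kt\<^sup>2)\<close> and \<open>exp (ct)\<close> times its value at
  \<open>t = 0\<close>, where \<open>c = A / v - \<alpha>\<^sub>1 r(B)\<close>. Whenever \<open>c \<rightarrow> -\<infinity>\<close>, the integral is therefore asymptotic to
  \<open>exp (- A\<^sup>2 / (2v)) \<Phi>(B) / |c|\<close>, and this covers all three cases: if \<open>B \<rightarrow> -\<infinity>\<close>, then \<open>r(B) + B \<rightarrow> 0\<close> and
  \<open>c\<close> is asymptotic to \<open>\<beta>\<^sub>1 F\<^sub>2\<^sup>-\<^sup>1(u)\<close>; otherwise \<open>r(B)\<close> stays bounded and \<open>c\<close> is asymptotic to \<open>A / v\<close>.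
  The sign of \<open>\<alpha>\<^sub>1 \<gamma>\<^sub>1 + \<alpha>\<^sub>2\<close>, read off the limit of \<open>B\<close>, forces \<open>\<beta>\<^sub>1 > 0\<close> in the first case and
  \<open>\<gamma>\<^sub>1 > \<rho>\<close>, hence \<open>A \<rightarrow> -\<infinity>\<close>, in the other two.
\<close>

subsection \<open>The reversed hazard rate of the normal distribution\<close>

lemma std_normal_density_has_real_derivative:
  "(std_normal_density has_real_derivative - x * std_normal_density x) (at x)"
  unfolding std_normal_density_def by (auto intro!: derivative_eq_intros simp: field_simps)

text \<open>Near x the cdf is a constant plus an integral over a compact interval starting at
  \<open>x - 1\<close>, so the fundamental theorem of calculus applies without an improper
  integral.\<close>

lemma std_normal_cdf_has_real_derivative:
  "(std_normal_cdf has_real_derivative std_normal_density x) (at x)"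
proof -
  interpret N: prob_space std_normal_distribution by (rule prob_space_normal_density) simp
  interpret R: finite_borel_measure std_normal_distribution by standard auto
  let ?a = "x - 1" and ?b = "x + 1"
  have cont: "continuous_on S std_normal_density" for S
    using std_normal_density_has_real_derivative
    by (intro DERIV_continuous_on[where D = "\<lambda>x. - x * std_normal_density x"])
       (blast intro: has_field_derivative_at_within)
  have eq: "std_normal_cdf y = std_normal_cdf ?a + integral {?a..y} std_normal_density"
    if "y \<in> {?a<..<?b}" for y
  proof -
    have int: "set_integrable lborel {?a..y} std_normal_density"
      by (rule borel_integrable_atLeastAtMost') (rule cont)
    have "std_normal_cdf y - std_normal_cdf ?a = measure std_normal_distribution {?a<..y}"
      using that by (intro R.cdf_diff_eq) auto
    also have "\<dots> = (LINT t:{?a<..y}|lborel. std_normal_density t)"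
      by (simp add: set_lebesgue_integral_def integral_eq_nn_integral measure_def
          emeasure_density nn_integral_set_ennreal mult_ac)
    also have "\<dots> = (LINT t:{?a..y}|lborel. std_normal_density t)"
    proof (rule set_integral_null_delta)
      have "sym_diff {?a<..y} {?a..y} = {?a}" using that by auto
      then show "sym_diff {?a<..y} {?a..y} \<in> null_sets lborel"
        by (simp add: countable_imp_null_set_lborel)
    qed auto
    also have "\<dots> = integral {?a..y} std_normal_density"
      by (rule set_borel_integral_eq_integral(2)[OF int])
    finally show ?thesis by simp
  qed
  have "((\<lambda>y. integral {?a..y} std_normal_density) has_real_derivative std_normal_density x)
      (at x within {?a..?b})"
    by (rule integral_has_real_derivative[OF cont]) simp
  then have "((\<lambda>y. integral {?a..y} std_normal_density) has_real_derivative std_normal_density x)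
      (at x within {?a<..<?b})"
    by (rule DERIV_subset) auto
  then have "((\<lambda>y. integral {?a..y} std_normal_density) has_real_derivative std_normal_density x) (at x)"
    by (subst (asm) at_within_open) auto
  then have "((\<lambda>y. std_normal_cdf ?a + integral {?a..y} std_normal_density)
      has_real_derivative std_normal_density x) (at x)"
    by (auto intro!: derivative_eq_intros)
  then show ?thesis
    by (rule has_field_derivative_transform_within_open[where S = "{?a<..<?b}"]) (auto simp: eq)
qed

section \<open>Decay at minus infinity and inequalities for the Mills ratio\<close>

lemma std_normal_cdf_poly_at_bot: "((\<lambda>x. x ^ n * std_normal_cdf x) \<longlongrightarrow> 0) at_bot"
proof (rule Lim_null_comparison)
  show "eventually (\<lambda>x. norm (x ^ n * std_normal_cdf x) \<le> \<bar>x\<bar> ^ n * exp (- x\<^sup>2 / 2)) at_bot"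
    using eventually_le_at_bot[of 0]
  proof eventually_elim
    case (elim x)
    then show ?case
      using mult_left_mono[OF std_normal_cdf_upper[of x], of "\<bar>x\<bar> ^ n"]
      by (simp add: abs_mult power_abs std_normal_cdf_bounds)
  qed
  show "((\<lambda>x::real. \<bar>x\<bar> ^ n * exp (- x\<^sup>2 / 2)) \<longlongrightarrow> 0) at_bot"
    by real_asymp
qed

lemma std_normal_density_poly_at_bot: "((\<lambda>x. x ^ n * std_normal_density x) \<longlongrightarrow> 0) at_bot"
  unfolding std_normal_density_def by real_asymp

text \<open>A nondecreasing function never lies below its limit at -\<infinity>. The three Mills
  inequalities follow from it as a chain: the sign of each derivative is supplied by the inequality
  before it, starting from \<Phi> \<ge> 0.\<close>

lemma nonneg_of_deriv_nonneg_at_bot: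
  fixes f :: "real \<Rightarrow> real"
  assumes "\<And>x. (f has_real_derivative f' x) (at x)" "\<And>x. 0 \<le> f' x" "(f \<longlongrightarrow> 0) at_bot"
  shows "0 \<le> f x"
proof (rule tendsto_upperbound[OF assms(3)])
  show "eventually (\<lambda>y. f y \<le> f x) at_bot"
    using eventually_le_at_bot[of x]
    by eventually_elim (use assms(1,2) in \<open>blast intro: DERIV_nonneg_imp_nondecreasing\<close>)
qed simp

text \<open>Divided by \<Phi>, this is r(x) + x \<ge> 0, which makes r' = - r (r + x)
  nonpositive.\<close>

lemma mills_ratio_upper: "0 \<le> std_normal_density x + x * std_normal_cdf x"
proof (rule nonneg_of_deriv_nonneg_at_bot[where f = "\<lambda>x. std_normal_density x + x * std_normal_cdf x"])
  show "((\<lambda>x. std_normal_density x + x * std_normal_cdf x) has_real_derivative std_normal_cdf x) (at x)" for x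
    by (auto intro!: derivative_eq_intros std_normal_density_has_real_derivative
          std_normal_cdf_has_real_derivative)
  show "((\<lambda>x. std_normal_density x + x * std_normal_cdf x) \<longlongrightarrow> 0) at_bot"
    using tendsto_add[OF std_normal_density_poly_at_bot[of 0] std_normal_cdf_poly_at_bot[of 1]] by simp
qed (rule std_normal_cdf_bounds)

text \<open>For x < 0, division by x \<Phi>(x) turns this into r(x) + x \<le> - 1 / x, the rate at
  which r(x) approaches - x.\<close>

lemma mills_ratio_lower: "0 \<le> (1 + x\<^sup>2) * std_normal_cdf x + x * std_normal_density x"
proof (rule nonneg_of_deriv_nonneg_at_bot[where
      f = "\<lambda>x. (1 + x\<^sup>2) * std_normal_cdf x + x * std_normal_density x"])
  show "((\<lambda>x. (1 + x\<^sup>2) * std_normal_cdf x + x * std_normal_density x) has_real_derivative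
      2 * (std_normal_density x + x * std_normal_cdf x)) (at x)" for x
    by (auto intro!: derivative_eq_intros std_normal_density_has_real_derivative
          std_normal_cdf_has_real_derivative simp: algebra_simps power2_eq_square)
  show "0 \<le> 2 * (std_normal_density x + x * std_normal_cdf x)" for x
    using mills_ratio_upper[of x] by simp
  show "((\<lambda>x. (1 + x\<^sup>2) * std_normal_cdf x + x * std_normal_density x) \<longlongrightarrow> 0) at_bot"
    using tendsto_add[OF tendsto_add[OF std_normal_cdf_poly_at_bot[of 0] std_normal_cdf_poly_at_bot[of 2]]
        std_normal_density_poly_at_bot[of 1]]
    by (simp add: algebra_simps)
qed

text \<open>Divided by the square of \<Phi>, this is r (r + x) \<le> 1, hence r' \<ge> -1.\<close>

lemma mills_ratio_quadratic:
  "0 \<le> (std_normal_cdf x)\<^sup>2 - x * std_normal_density x * std_normal_cdf x - (std_normal_density x)\<^sup>2"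
proof (rule nonneg_of_deriv_nonneg_at_bot[where
      f = "\<lambda>x. (std_normal_cdf x)\<^sup>2 - x * std_normal_density x * std_normal_cdf x - (std_normal_density x)\<^sup>2"])
  show "((\<lambda>x. (std_normal_cdf x)\<^sup>2 - x * std_normal_density x * std_normal_cdf x - (std_normal_density x)\<^sup>2)
      has_real_derivative std_normal_density x * ((1 + x\<^sup>2) * std_normal_cdf x + x * std_normal_density x)) (at x)" for x
    by (auto intro!: derivative_eq_intros std_normal_density_has_real_derivative
          std_normal_cdf_has_real_derivative simp: algebra_simps power2_eq_square)
  show "0 \<le> std_normal_density x * ((1 + x\<^sup>2) * std_normal_cdf x + x * std_normal_density x)" for x
    using mills_ratio_lower[of x] by simp
  note P = std_normal_cdf_poly_at_bot[of 0, simplified] std_normal_density_poly_at_bot[of 0, simplified]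
    std_normal_density_poly_at_bot[of 1, simplified]
  show "((\<lambda>x. (std_normal_cdf x)\<^sup>2 - x * std_normal_density x * std_normal_cdf x - (std_normal_density x)\<^sup>2)
      \<longlongrightarrow> 0) at_bot"
    by (rule tendsto_eq_intros P refl)+ simp
qed

section \<open>Derivative bounds and limits of the reversed hazard rate\<close>

definition std_normal_rev_hazard :: "real \<Rightarrow> real" where
  "std_normal_rev_hazard x = std_normal_density x / std_normal_cdf x"

lemma std_normal_rev_hazard_nonneg: "0 \<le> std_normal_rev_hazard x"
  by (simp add: std_normal_rev_hazard_def std_normal_cdf_bounds)

lemma std_normal_rev_hazard_has_real_derivative:
  "(std_normal_rev_hazard has_real_derivative - std_normal_rev_hazard x * (std_normal_rev_hazard x + x)) (at x)"
  unfolding std_normal_rev_hazard_def [abs_def] using std_normal_cdf_pos[of x]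
  by (auto intro!: derivative_eq_intros std_normal_density_has_real_derivative
        std_normal_cdf_has_real_derivative simp: field_simps power2_eq_square)

lemma ln_std_normal_cdf_has_real_derivative:
  "((\<lambda>x. ln (std_normal_cdf x)) has_real_derivative std_normal_rev_hazard x) (at x)"
  unfolding std_normal_rev_hazard_def using std_normal_cdf_pos[of x]
  by (auto intro!: derivative_eq_intros std_normal_cdf_has_real_derivative)

lemma std_normal_rev_hazard_add_self_nonneg: "0 \<le> std_normal_rev_hazard x + x"
  using mills_ratio_upper[of x] std_normal_cdf_pos[of x]
  by (simp add: std_normal_rev_hazard_def field_simps)

lemma std_normal_rev_hazard_deriv_bounds:
  "0 \<le> std_normal_rev_hazard x * (std_normal_rev_hazard x + x)"
  "std_normal_rev_hazard x * (std_normal_rev_hazard x + x) \<le> 1"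
proof -
  show "0 \<le> std_normal_rev_hazard x * (std_normal_rev_hazard x + x)"
    by (intro mult_nonneg_nonneg std_normal_rev_hazard_nonneg std_normal_rev_hazard_add_self_nonneg)
  show "std_normal_rev_hazard x * (std_normal_rev_hazard x + x) \<le> 1"
    using std_normal_cdf_pos[of x] mills_ratio_quadratic[of x]
    by (simp add: std_normal_rev_hazard_def field_simps power2_eq_square)
qed

text \<open>The Taylor expansion of \<open>ln \<Phi>\<close>, whose second derivative lies in \<open>[-1, 0]\<close>.\<close>

lemma std_normal_cdf_add_bounds:
  "std_normal_cdf b * exp (h * std_normal_rev_hazard b - h\<^sup>2 / 2) \<le> std_normal_cdf (b + h)"
  "std_normal_cdf (b + h) \<le> std_normal_cdf b * exp (h * std_normal_rev_hazard b)"
proof -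
  \<comment> \<open>Index 0 is ln \<Phi>(b + t), index 1 its derivative, and every later index holds
    the second derivative, because the expansion stops at order 2.\<close>
  define D where "D m t = (if m = 0 then ln (std_normal_cdf (b + t))
     else if m = 1 then std_normal_rev_hazard (b + t)
     else - std_normal_rev_hazard (b + t) * (std_normal_rev_hazard (b + t) + (b + t)))" for m :: nat and t
  have "\<forall>m t. m < 2 \<and> \<bar>t\<bar> \<le> \<bar>h\<bar> \<longrightarrow> (D m has_real_derivative D (Suc m) t) (at t)"
  proof (intro allI impI)
    fix m :: nat and t assume "m < 2 \<and> \<bar>t\<bar> \<le> \<bar>h\<bar>"
    then consider "m = 0" | "m = 1" by linarith
    then show "(D m has_real_derivative D (Suc m) t) (at t)"
    proof cases
      case 1
      then show ?thesis
        using ln_std_normal_cdf_has_real_derivative[of "b + t"] DERIV_shift[of "\<lambda>x. ln (std_normal_cdf x)" _ t b]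
        by (simp add: D_def[abs_def] add.commute)
    next
      case 2
      then show ?thesis
        using std_normal_rev_hazard_has_real_derivative[of "b + t"] DERIV_shift[of std_normal_rev_hazard _ t b]
        by (simp add: D_def[abs_def] add.commute)
    qed
  qed
  \<comment> \<open>The two-sided expansion is required: the increment will be
    \<open>- (a1 * t)\<close>, and \<open>a1\<close> may have either sign.\<close>
  from Maclaurin_bi_le[of D "D 0" 2 h, OF refl this]
  obtain t where "D 0 h = D 0 0 + D 1 0 * h + D 2 t / 2 * h\<^sup>2"
    by (auto simp: eval_nat_numeral)
  then have "ln (std_normal_cdf (b + h)) = ln (std_normal_cdf b) + h * std_normal_rev_hazard b
      - std_normal_rev_hazard (b + t) * (std_normal_rev_hazard (b + t) + (b + t)) / 2 * h\<^sup>2"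
    by (simp add: D_def mult_ac)
  moreover define q where "q = std_normal_rev_hazard (b + t) * (std_normal_rev_hazard (b + t) + (b + t)) / 2 * h\<^sup>2"
  ultimately have "ln (std_normal_cdf (b + h)) = ln (std_normal_cdf b) + (h * std_normal_rev_hazard b - q)"
    by simp
  then have "exp (ln (std_normal_cdf (b + h))) = exp (ln (std_normal_cdf b) + (h * std_normal_rev_hazard b - q))"
    by simp
  then have eq: "std_normal_cdf (b + h) = std_normal_cdf b * exp (h * std_normal_rev_hazard b - q)"
    by (simp add: exp_add std_normal_cdf_pos)
  have q: "0 \<le> q" "q \<le> h\<^sup>2 / 2"
    using std_normal_rev_hazard_deriv_bounds[of "b + t"] mult_right_mono[of _ 1 "h\<^sup>2 / 2"]
    by (auto simp: q_def)
  show "std_normal_cdf b * exp (h * std_normal_rev_hazard b - h\<^sup>2 / 2) \<le> std_normal_cdf (b + h)"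
    "std_normal_cdf (b + h) \<le> std_normal_cdf b * exp (h * std_normal_rev_hazard b)"
    unfolding eq using q by (auto intro!: mult_left_mono std_normal_cdf_bounds)
qed

lemma std_normal_rev_hazard_add_self_at_bot: "((\<lambda>x. std_normal_rev_hazard x + x) \<longlongrightarrow> 0) at_bot"
proof (rule tendsto_sandwich[of "\<lambda>_. 0" _ _ "\<lambda>x. - inverse x"])
  show "eventually (\<lambda>x. 0 \<le> std_normal_rev_hazard x + x) at_bot"
    by (simp add: std_normal_rev_hazard_add_self_nonneg)
  show "eventually (\<lambda>x. std_normal_rev_hazard x + x \<le> - inverse x) at_bot"
    using eventually_gt_at_bot[of 0]
  proof eventually_elim
    case (elim x)
    then show ?case
      using mills_ratio_lower[of x] std_normal_cdf_pos[of x]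
      by (simp add: std_normal_rev_hazard_def field_simps power2_eq_square)
  qed
  show "((\<lambda>x::real. - inverse x) \<longlongrightarrow> 0) at_bot" by real_asymp
qed simp


lemma std_normal_cdf_asymp_at_bot:
  "((\<lambda>x. std_normal_cdf x * \<bar>x\<bar> / std_normal_density x) \<longlongrightarrow> 1) at_bot"
proof -
  have i: "((\<lambda>x::real. inverse x) \<longlongrightarrow> 0) at_bot" by real_asymp
  have "((\<lambda>x. inverse (1 - (std_normal_rev_hazard x + x) * inverse x)) \<longlongrightarrow> inverse (1 - 0 * 0)) at_bot"
    by (intro tendsto_intros std_normal_rev_hazard_add_self_at_bot i) simp
  moreover have "eventually (\<lambda>x. inverse (1 - (std_normal_rev_hazard x + x) * inverse x) =
      std_normal_cdf x * \<bar>x\<bar> / std_normal_density x) at_bot"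
    using eventually_gt_at_bot[of 0]
  proof eventually_elim
    case (elim x)
    then have "1 - (std_normal_rev_hazard x + x) * inverse x = std_normal_rev_hazard x / \<bar>x\<bar>"
      by (simp add: field_simps)
    then show ?case by (simp add: std_normal_rev_hazard_def)
  qed
  ultimately show ?thesis by (simp add: Lim_transform_eventually)
qed

text \<open>By symmetry of the density, \<Phi>(x) + \<Phi>(-x) has derivative zero; its constant
  value is 1 by the limit at \<infinity>. This gives the additional factor 2 in the denominator when
  B tends to 0.\<close>

lemma std_normal_cdf_0: "std_normal_cdf 0 = 1 / 2"
proof -
  interpret N: prob_space std_normal_distribution by (rule prob_space_normal_density) simp
  interpret R: real_distribution std_normal_distribution by standard auto
  have "((\<lambda>x. std_normal_cdf x + std_normal_cdf (- x)) has_real_derivative 0) (at x)" for x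
  proof -
    have "((\<lambda>x. std_normal_cdf (- x)) has_real_derivative - std_normal_density (- x)) (at x)"
      using std_normal_cdf_has_real_derivative by (simp only: DERIV_mirror[symmetric])
    also have "std_normal_density (- x) = std_normal_density x"
      by (simp add: std_normal_density_def)
    finally have "((\<lambda>x. std_normal_cdf (- x)) has_real_derivative - std_normal_density x) (at x)" .
    from DERIV_add[OF std_normal_cdf_has_real_derivative this] show ?thesis by simp
  qed
  then have "std_normal_cdf x + std_normal_cdf (- x) = std_normal_cdf 0 + std_normal_cdf (- 0)" for x
    by (rule DERIV_isconst_all[rule_format, of "\<lambda>x. std_normal_cdf x + std_normal_cdf (- x)"])
  then have "((\<lambda>x. std_normal_cdf x + std_normal_cdf (- x)) \<longlongrightarrow> 2 * std_normal_cdf 0) at_top"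
    by simp
  moreover have "((\<lambda>x. std_normal_cdf x + std_normal_cdf (- x)) \<longlongrightarrow> 1 + 0) at_top"
    by (intro tendsto_add R.cdf_lim_at_top_prob
        filterlim_compose[OF R.cdf_lim_at_bot filterlim_uminus_at_bot_at_top])
  ultimately have "2 * std_normal_cdf 0 = 1"
    by (metis add_0_right tendsto_unique trivial_limit_at_top_linorder)
  then show ?thesis by simp
qed

subsection \<open>Asymptotics of the conditional distribution function\<close>

lemma has_bochner_integral_power_exp_Ici:
  assumes "0 < a"
  shows "has_bochner_integral lborel (\<lambda>t::real. indicator {0..} t * (t ^ k * exp (- (a * t)))) (fact k / a ^ (k + 1))"
proof (rule has_bochner_integral_nn_integral)
  have "(\<integral>\<^sup>+ t. ennreal (indicator {0..} t * (t ^ k * exp (- (a * t)))) \<partial>lborel) =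
      (\<integral>\<^sup>+ t. ennreal (1 / a) * ennreal (erlang_density 0 a t * t ^ k) \<partial>lborel)"
    using assms
    by (intro nn_integral_cong)
       (auto simp: erlang_density_def ennreal_mult'[symmetric] split: split_indicator)
  also have "\<dots> = ennreal (1 / a) * ennreal (fact k / a ^ k)"
    by (subst nn_integral_cmult) (simp_all add: nn_integral_erlang_ith_moment[OF assms])
  also have "\<dots> = ennreal (fact k / a ^ (k + 1))"
    using assms by (simp add: ennreal_mult'[symmetric])
  finally show "(\<integral>\<^sup>+ t. ennreal (indicator {0..} t * (t ^ k * exp (- (a * t)))) \<partial>lborel) =
      ennreal (fact k / a ^ (k + 1))" .
qed (use assms in \<open>auto intro!: AE_I2 split: split_indicator\<close>)

text \<open>The upper bound integrates \<open>P * exp (c * t)\<close>. For the lower one, the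
  Gaussian factor is replaced by its tangent \<open>1 - K * t^2\<close>, and the moments of order 0
  and 2 of \<open>exp (c * t)\<close> are 1 / |c| and 2 / |c|^3.\<close>

lemma laplace_integral_bounds:
  fixes F :: "real \<Rightarrow> real"
  assumes F: "F \<in> borel_measurable borel" and c: "c < 0" and K: "0 \<le> K" and P: "0 \<le> P"
    and lower: "\<And>t. 0 \<le> t \<Longrightarrow> P * exp (c * t - K * t\<^sup>2) \<le> F t"
    and upper: "\<And>t. 0 \<le> t \<Longrightarrow> F t \<le> P * exp (c * t)"
  shows "P / \<bar>c\<bar> * (1 - 2 * K / c\<^sup>2) \<le> (LINT t:{0..}|lborel. F t)"
    and "(LINT t:{0..}|lborel. F t) \<le> P / \<bar>c\<bar>"
proof -
  have E: "has_bochner_integral lborel (\<lambda>t. indicator {0..} t * (t ^ k * exp (- (- c * t))))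
      (fact k / (- c) ^ (k + 1))" for k
    using c by (intro has_bochner_integral_power_exp_Ici) simp
  have up: "has_bochner_integral lborel (\<lambda>t. P * (indicator {0..} t * (t ^ 0 * exp (- (- c * t))))) (P / \<bar>c\<bar>)"
    using has_bochner_integral_mult_right[OF E[of 0], of P] c by simp
  have "has_bochner_integral lborel (\<lambda>t. P * (indicator {0..} t * (t ^ 0 * exp (- (- c * t))) -
      K * (indicator {0..} t * (t ^ 2 * exp (- (- c * t)))))) (P * (1 / (- c) - K * (2 / (- c) ^ 3)))"
    using has_bochner_integral_mult_right[OF has_bochner_integral_diff[OF E[of 0]
          has_bochner_integral_mult_right[OF E[of 2], of K]], of P]
    by (simp add: eval_nat_numeral)
  moreover have "P * (1 / (- c) - K * (2 / (- c) ^ 3)) = P / \<bar>c\<bar> * (1 - 2 * K / c\<^sup>2)"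
    using c by (simp add: field_simps power2_eq_square power3_eq_cube)
  ultimately have lo: "has_bochner_integral lborel (\<lambda>t. P * (indicator {0..} t * (t ^ 0 * exp (- (- c * t))) -
      K * (indicator {0..} t * (t ^ 2 * exp (- (- c * t)))))) (P / \<bar>c\<bar> * (1 - 2 * K / c\<^sup>2))"
    by simp
  have F0: "0 \<le> F t" if "0 \<le> t" for t
    using lower[OF that] P by (meson exp_ge_zero mult_nonneg_nonneg order_trans)
  have int: "integrable lborel (\<lambda>t. indicator {0..} t *\<^sub>R F t)"
    using F by (intro Bochner_Integration.integrable_bound[OF has_bochner_integral_iff[THEN iffD1, THEN conjunct1, OF up]])
      (auto simp: F0 P intro!: AE_I2 upper split: split_indicator)
  show "(LINT t:{0..}|lborel. F t) \<le> P / \<bar>c\<bar>"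
    unfolding set_lebesgue_integral_def has_bochner_integral_integral_eq[OF up, symmetric]
    by (rule integral_mono[OF int has_bochner_integral_iff[THEN iffD1, THEN conjunct1, OF up]])
       (auto simp: upper split: split_indicator)
  have "P * (exp (c * t) - K * (t\<^sup>2 * exp (c * t))) \<le> F t" if "0 \<le> t" for t
  proof -
    have "exp (c * t) - K * (t\<^sup>2 * exp (c * t)) = exp (c * t) * (1 + - (K * t\<^sup>2))"
      by (simp add: algebra_simps)
    also have "\<dots> \<le> exp (c * t) * exp (- (K * t\<^sup>2))"
      by (intro mult_left_mono exp_ge_add_one_self) simp
    also have "\<dots> = exp (c * t - K * t\<^sup>2)" by (simp add: exp_diff exp_minus divide_inverse)
    finally show ?thesis using lower[OF that] mult_left_mono[OF _ P] by (meson order_trans)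
  qed
  then show "P / \<bar>c\<bar> * (1 - 2 * K / c\<^sup>2) \<le> (LINT t:{0..}|lborel. F t)"
    unfolding set_lebesgue_integral_def has_bochner_integral_integral_eq[OF lo, symmetric]
    by (intro integral_mono[OF has_bochner_integral_iff[THEN iffD1, THEN conjunct1, OF lo] int])
       (auto split: split_indicator)
qed

text \<open>The relative error is at most a constant over \<open>c^2\<close>, and the constant
  depends only on \<rho> and \<open>a1\<close>. The bounds therefore stay useful while x and y vary,
  as long as c tends to -\<infinity>.\<close>

lemma cond_cdf_sn2_bounds:
  assumes \<rho>: "-1 < \<rho>" "\<rho> < 1"
  defines "v \<equiv> 1 - \<rho>\<^sup>2"
  assumes A: "A = x - \<rho> * y" and B: "B = a1 * x + a2 * y"
    and c: "c = A / v - a1 * std_normal_rev_hazard B" "c < 0"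
    and P: "P = exp (- A\<^sup>2 / (2 * v)) * std_normal_cdf B /
      (sqrt (2 * pi) * sqrt v * std_normal_cdf (sn2_lambda2 (a1, a2) \<rho> * y))"
  shows "P / \<bar>c\<bar> * (1 - (1 / v + a1\<^sup>2) / c\<^sup>2) \<le> cond_cdf (sn2_density (a1, a2) \<rho>) x y"
    and "cond_cdf (sn2_density (a1, a2) \<rho>) x y \<le> P / \<bar>c\<bar>"
proof -
  have v: "0 < v" using \<rho> by (simp add: v_def abs_square_less_1)
  define N where "N = sqrt (2 * pi) * sqrt v * std_normal_cdf (sn2_lambda2 (a1, a2) \<rho> * y)"
  have N: "0 < N" using v by (simp add: N_def std_normal_cdf_pos)
  define F where "F t = exp (- (A - t)\<^sup>2 / (2 * v)) * std_normal_cdf (B - a1 * t) / N" for t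
  have "cond_cdf (sn2_density (a1, a2) \<rho>) x y =
    (LINT z:{..x}|lborel. 1 / sqrt (2 * pi * v) * exp (- (z - \<rho> * y)\<^sup>2 / (2 * v))
       * (std_normal_cdf (a1 * z + a2 * y) / std_normal_cdf (sn2_lambda2 (a1, a2) \<rho> * y)))"
    unfolding v_def by (rule cond_cdf_sn2[OF \<rho>])
  also have "\<dots> = (LINT t:{0..}|lborel. F t)"
    unfolding set_lebesgue_integral_def
    by (subst lborel_integral_real_affine[where c = "-1" and t = x])
       (auto intro!: Bochner_Integration.integral_cong split: split_indicator
          simp: F_def A B N_def real_sqrt_mult algebra_simps)
  finally have eq: "cond_cdf (sn2_density (a1, a2) \<rho>) x y = (LINT t:{0..}|lborel. F t)" .
  \<comment> \<open>The term 1 / v is the curvature of the Gaussian exponent; \<open>a1^2\<close>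
    bounds the curvature of t \<mapsto> ln \<Phi>(B - \<open>a1\<close> t).\<close>
  define K where "K = (1 / v + a1\<^sup>2) / 2"
  have K2: "2 * K = 1 / v + a1\<^sup>2" by (simp add: K_def)
  have K: "0 \<le> K" using v by (simp add: K_def)
  have PN: "P = exp (- A\<^sup>2 / (2 * v)) * std_normal_cdf B / N" by (simp add: P N_def)
  have square: "- (A - t)\<^sup>2 / (2 * v) = - A\<^sup>2 / (2 * v) + (A / v * t - t\<^sup>2 / (2 * v))" for t
    using v by (simp add: field_simps power2_eq_square)
  have meas: "F \<in> borel_measurable borel" unfolding F_def by measurable
  have lower: "P * exp (c * t - K * t\<^sup>2) \<le> F t" for t
  proof -
    have "exp (c * t - K * t\<^sup>2) = exp (A / v * t - t\<^sup>2 / (2 * v)) *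
        exp ((- (a1 * t)) * std_normal_rev_hazard B - (- (a1 * t))\<^sup>2 / 2)"
      unfolding mult_exp_exp
      by (rule arg_cong[of _ _ exp]) (simp add: c K_def algebra_simps add_divide_distrib power_mult_distrib)
    then have "P * exp (c * t - K * t\<^sup>2) = exp (- A\<^sup>2 / (2 * v)) * exp (A / v * t - t\<^sup>2 / (2 * v)) / N *
        (std_normal_cdf B * exp ((- (a1 * t)) * std_normal_rev_hazard B - (- (a1 * t))\<^sup>2 / 2))"
      by (simp add: PN)
    also have "\<dots> \<le> exp (- A\<^sup>2 / (2 * v)) * exp (A / v * t - t\<^sup>2 / (2 * v)) / N * std_normal_cdf (B + - (a1 * t))"
      using N by (intro mult_left_mono std_normal_cdf_add_bounds) simp
    also have "\<dots> = F t" unfolding F_def square exp_add by simp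
    finally show ?thesis .
  qed
  have upper: "F t \<le> P * exp (c * t)" for t
  proof -
    have "F t = exp (- A\<^sup>2 / (2 * v)) * exp (A / v * t - t\<^sup>2 / (2 * v)) / N * std_normal_cdf (B + - (a1 * t))"
      unfolding F_def square exp_add by simp
    \<comment> \<open>The factor \<open>exp (- t^2 / (2 * v))\<close> is at most 1 and is dropped;
      in the lower bound it is absorbed into K.\<close>
    also have "\<dots> \<le> exp (- A\<^sup>2 / (2 * v)) * exp (A / v * t) / N *
        (std_normal_cdf B * exp ((- (a1 * t)) * std_normal_rev_hazard B))"
      using N v
      by (intro mult_mono divide_right_mono mult_left_mono std_normal_cdf_add_bounds)
         (auto simp: std_normal_cdf_bounds)
    also have "\<dots> = P * (exp (A / v * t) * exp ((- (a1 * t)) * std_normal_rev_hazard B))"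
      by (simp add: PN)
    also have "exp (A / v * t) * exp ((- (a1 * t)) * std_normal_rev_hazard B) = exp (c * t)"
      unfolding mult_exp_exp by (simp add: c algebra_simps)
    finally show ?thesis .
  qed
  have P0: "0 \<le> P" using N by (simp add: PN std_normal_cdf_bounds)
  show "cond_cdf (sn2_density (a1, a2) \<rho>) x y \<le> P / \<bar>c\<bar>"
    unfolding eq by (rule laplace_integral_bounds(2)[OF meas c(2) K P0 lower upper])
  show "P / \<bar>c\<bar> * (1 - (1 / v + a1\<^sup>2) / c\<^sup>2) \<le> cond_cdf (sn2_density (a1, a2) \<rho>) x y"
    using laplace_integral_bounds(1)[OF meas c(2) K P0 lower upper]
    unfolding eq[symmetric] by (simp add: K2)
qed

section \<open>Asymptotic equivalence along a filter, first in general and then by the behaviour of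
  \<Phi>(B)\<close>

lemma cond_cdf_sn2_asymp:
  fixes x y :: "'b \<Rightarrow> real" and a1 a2 \<rho> :: real
  assumes \<rho>: "-1 < \<rho>" "\<rho> < 1"
  defines "v \<equiv> 1 - \<rho>\<^sup>2"
  defines "A \<equiv> \<lambda>u. x u - \<rho> * y u" and "B \<equiv> \<lambda>u. a1 * x u + a2 * y u"
  defines "c \<equiv> \<lambda>u. A u / v - a1 * std_normal_rev_hazard (B u)"
  assumes c: "filterlim c at_bot F"
  shows "(\<lambda>u. cond_cdf (sn2_density (a1, a2) \<rho>) (x u) (y u)) \<sim>[F]
    (\<lambda>u. exp (- (A u)\<^sup>2 / (2 * v)) * std_normal_cdf (B u) /
      (sqrt (2 * pi) * sqrt v * std_normal_cdf (sn2_lambda2 (a1, a2) \<rho> * y u)) / \<bar>c u\<bar>)"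
    (is "?f \<sim>[F] ?g")
proof (rule asymp_equivI', rule tendsto_sandwich)
  have v: "0 < v" using \<rho> by (simp add: v_def abs_square_less_1)
  have neg: "eventually (\<lambda>u. c u < 0) F"
    using c unfolding filterlim_at_bot_dense by blast
  have g: "0 < ?g u" if "c u < 0" for u
    using that v by (intro divide_pos_pos mult_pos_pos std_normal_cdf_pos exp_gt_zero) simp_all
  have bounds: "?g u * (1 - (1 / v + a1\<^sup>2) / (c u)\<^sup>2) \<le> ?f u" "?f u \<le> ?g u" if "c u < 0" for u
    using cond_cdf_sn2_bounds[OF \<rho>, of "A u" "x u" "y u" "B u" a1 a2 "c u", folded v_def, OF _ _ _ that refl]
    by (simp_all add: A_def B_def c_def)
  show "eventually (\<lambda>u. 1 - (1 / v + a1\<^sup>2) / (c u)\<^sup>2 \<le> ?f u / ?g u) F"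
    using neg
  proof eventually_elim
    case (elim u)
    show ?case
      using bounds(1)[OF elim] unfolding pos_le_divide_eq[OF g[OF elim]] by (simp only: mult.commute)
  qed
  show "eventually (\<lambda>u. ?f u / ?g u \<le> 1) F"
    using neg
  proof eventually_elim
    case (elim u)
    show ?case
      using bounds(2)[OF elim] unfolding pos_divide_le_eq[OF g[OF elim]] by simp
  qed
  have "((\<lambda>x. 1 - (1 / v + a1\<^sup>2) / x\<^sup>2) \<longlongrightarrow> 1) at_bot" by real_asymp
  then show "((\<lambda>u. 1 - (1 / v + a1\<^sup>2) / (c u)\<^sup>2) \<longlongrightarrow> 1) F"
    by (rule filterlim_compose[OF _ c])
qed simp

text \<open>Serves both B \<rightarrow> 0, with L = 1/2, and B \<rightarrow> \<infinity>, with L =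
  1. As \<Phi>(B) stays away from 0, the hazard r(B) is bounded and A / v dominates c.\<close>

lemma cond_cdf_sn2_asymp_cdf_pos_limit:
  fixes x y :: "'b \<Rightarrow> real" and a1 a2 \<rho> :: real
  assumes \<rho>: "-1 < \<rho>" "\<rho> < 1"
  defines "A \<equiv> \<lambda>u. x u - \<rho> * y u" and "B \<equiv> \<lambda>u. a1 * x u + a2 * y u"
  assumes A: "filterlim A at_bot F"
    and L: "((\<lambda>u. std_normal_cdf (B u)) \<longlongrightarrow> L) F" "0 < L"
  shows "(\<lambda>u. cond_cdf (sn2_density (a1, a2) \<rho>) (x u) (y u)) \<sim>[F]
    (\<lambda>u. L * (sqrt (1 - \<rho>\<^sup>2) * exp (- (A u)\<^sup>2 / (2 * (1 - \<rho>\<^sup>2)))) /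
      (sqrt (2 * pi) * \<bar>A u\<bar> * std_normal_cdf (sn2_lambda2 (a1, a2) \<rho> * y u)))"
proof -
  define v where "v = 1 - \<rho>\<^sup>2"
  have v: "0 < v" using \<rho> by (simp add: v_def abs_square_less_1)
  define c where "c = (\<lambda>u. A u / v - a1 * std_normal_rev_hazard (B u))"
  have neg: "eventually (\<lambda>u. A u < 0) F"
    using A unfolding filterlim_at_bot_dense by blast
  have "((\<lambda>u. inverse (A u)) \<longlongrightarrow> 0) F"
    using A filterlim_at_bot_imp_at_infinity filterlim_compose tendsto_inverse_0 by blast
  then have "((\<lambda>u. inverse \<bar>A u\<bar>) \<longlongrightarrow> 0) F"
    by (simp add: tendsto_rabs_zero_iff flip: abs_inverse)
  then have "((\<lambda>u. inverse (std_normal_cdf (B u)) * inverse \<bar>A u\<bar>) \<longlongrightarrow> inverse L * 0) F"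
    using L by (intro tendsto_mult tendsto_inverse) auto
  then have null: "((\<lambda>u. inverse (std_normal_cdf (B u)) * inverse \<bar>A u\<bar>) \<longlongrightarrow> 0) F" by simp
  \<comment> \<open>Since the density is at most 1, r is at most 1 / \<Phi>; thus convergence of
    \<Phi>(B) alone controls r(B).\<close>
  have le: "\<bar>std_normal_rev_hazard z\<bar> \<le> inverse (std_normal_cdf z)" for z
  proof -
    have "exp (- z\<^sup>2 / 2) \<le> 1" by simp
    also have "1 \<le> sqrt (2 * pi)" using pi_ge_two by (intro real_le_rsqrt) simp
    finally have "std_normal_density z \<le> 1" by (simp add: std_normal_density_def divide_le_eq)
    then show ?thesis
      using std_normal_cdf_pos[of z] std_normal_rev_hazard_nonneg[of z]
      by (simp add: std_normal_rev_hazard_def divide_inverse)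
  qed
  have "((\<lambda>u. std_normal_rev_hazard (B u) / A u) \<longlongrightarrow> 0) F"
  proof (rule Lim_null_comparison[OF _ null], intro always_eventually allI)
    fix u
    show "norm (std_normal_rev_hazard (B u) / A u) \<le> inverse (std_normal_cdf (B u)) * inverse \<bar>A u\<bar>"
      using mult_right_mono[OF le[of "B u"], of "inverse \<bar>A u\<bar>"]
      by (simp add: divide_inverse abs_mult)
  qed
  then have "((\<lambda>u. 1 / v - a1 * (std_normal_rev_hazard (B u) / A u)) \<longlongrightarrow> 1 / v - a1 * 0) F"
    by (intro tendsto_intros)
  moreover have "eventually (\<lambda>u. 1 / v - a1 * (std_normal_rev_hazard (B u) / A u) = c u / A u) F"
    using neg by eventually_elim (simp add: c_def diff_divide_distrib)
  ultimately have cA: "((\<lambda>u. c u / A u) \<longlongrightarrow> 1 / v) F"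
    by (simp add: Lim_transform_eventually)
  have "filterlim (\<lambda>u. c u / A u * A u) at_bot F"
    using v by (intro filterlim_tendsto_pos_mult_at_bot[OF cA _ A]) simp
  then have c: "filterlim c at_bot F"
    by (rule filterlim_cong[THEN iffD1, OF refl refl, rotated])
       (use neg in \<open>eventually_elim, simp\<close>)
  have "(\<lambda>u. cond_cdf (sn2_density (a1, a2) \<rho>) (x u) (y u)) \<sim>[F]
    (\<lambda>u. exp (- (A u)\<^sup>2 / (2 * v)) * std_normal_cdf (B u) /
      (sqrt (2 * pi) * sqrt v * std_normal_cdf (sn2_lambda2 (a1, a2) \<rho> * y u)) / \<bar>c u\<bar>)"
    using cond_cdf_sn2_asymp[OF \<rho>, of x y a1 a2 F] c
    unfolding A_def B_def c_def v_def by blast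
  also have "\<dots> \<sim>[F] (\<lambda>u. L * (sqrt v * exp (- (A u)\<^sup>2 / (2 * v))) /
      (sqrt (2 * pi) * \<bar>A u\<bar> * std_normal_cdf (sn2_lambda2 (a1, a2) \<rho> * y u)))" (is "?f \<sim>[F] ?g")
  proof (rule asymp_equivI')
    have "((\<lambda>u. std_normal_cdf (B u) / L * inverse (v * (c u / A u))) \<longlongrightarrow> L / L * inverse (v * (1 / v))) F"
      using v L by (intro tendsto_intros cA) auto
    moreover have "eventually (\<lambda>u. c u < 0) F"
      using c unfolding filterlim_at_bot_dense by blast
    with neg have "eventually (\<lambda>u. std_normal_cdf (B u) / L * inverse (v * (c u / A u)) = ?f u / ?g u) F"
    proof eventually_elim
      case (elim u)
      have ratio: "P / L * inverse (s * s * (c / A)) =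
          e * P / (p * s * N) / \<bar>c\<bar> / (L * (s * e) / (p * \<bar>A\<bar> * N))"
        if "0 < e" "0 < p" "0 < s" "0 < N" "c < 0" "A < 0" for e P p s N c A :: real
        using that L by (simp add: field_simps)
      have "sqrt v * sqrt v = v" using v by simp
      then show ?case
        using ratio[of "exp (- (A u)\<^sup>2 / (2 * v))" "sqrt (2 * pi)" "sqrt v"
            "std_normal_cdf (sn2_lambda2 (a1, a2) \<rho> * y u)" "c u" "A u" "std_normal_cdf (B u)"]
          elim v std_normal_cdf_pos by simp
    qed
    ultimately show "((\<lambda>u. ?f u / ?g u) \<longlongrightarrow> 1) F"
      using v L by (simp add: Lim_transform_eventually)
  qed
  finally show ?thesis unfolding v_def .
qed

text \<open>Here r(B) grows like -B and contributes to c at the same order as A. The rate c is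
  measured against y, with limit \<beta> for c / y, and \<Phi>(B) is replaced by its Mills
  asymptotics \<phi>(B) / |B|.\<close>

lemma cond_cdf_sn2_asymp_cdf_null:
  fixes x y :: "'b \<Rightarrow> real" and a1 a2 g \<rho> :: real
  assumes \<rho>: "-1 < \<rho>" "\<rho> < 1"
  defines "A \<equiv> \<lambda>u. x u - \<rho> * y u" and "B \<equiv> \<lambda>u. a1 * x u + a2 * y u"
  assumes y: "filterlim y at_bot F" and ratio: "((\<lambda>u. x u / y u) \<longlongrightarrow> g) F" and B: "filterlim B at_bot F"
  defines "\<beta> \<equiv> (g - \<rho>) / (1 - \<rho>\<^sup>2) + a1 * (a1 * g + a2)"
  assumes \<beta>: "0 < \<beta>"
  shows "(\<lambda>u. cond_cdf (sn2_density (a1, a2) \<rho>) (x u) (y u)) \<sim>[F]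
    (\<lambda>u. exp (- (A u)\<^sup>2 / (2 * (1 - \<rho>\<^sup>2)) - (B u)\<^sup>2 / 2) /
      (2 * pi * sqrt (1 - \<rho>\<^sup>2) * \<beta> * \<bar>y u\<bar> * std_normal_cdf (sn2_lambda2 (a1, a2) \<rho> * y u) * \<bar>B u\<bar>))"
proof -
  define v where "v = 1 - \<rho>\<^sup>2"
  have v: "0 < v" using \<rho> by (simp add: v_def abs_square_less_1)
  define c where "c = (\<lambda>u. A u / v - a1 * std_normal_rev_hazard (B u))"
  have neg: "eventually (\<lambda>u. y u < 0) F"
    using y unfolding filterlim_at_bot_dense by blast
  have "((\<lambda>u. inverse (y u)) \<longlongrightarrow> 0) F"
    using y filterlim_at_bot_imp_at_infinity filterlim_compose tendsto_inverse_0 by blast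
  \<comment> \<open>Writing - r(B) = B - (r(B) + B) splits c / y into the two summands of \<beta>,
    before the limit, and a vanishing remainder.\<close>
  then have "((\<lambda>u. (x u / y u - \<rho>) / v + a1 * (a1 * (x u / y u) + a2) -
      a1 * ((std_normal_rev_hazard (B u) + B u) * inverse (y u))) \<longlongrightarrow>
      (g - \<rho>) / v + a1 * (a1 * g + a2) - a1 * (0 * 0)) F"
    using v by (intro tendsto_intros ratio filterlim_compose[OF std_normal_rev_hazard_add_self_at_bot B]) auto
  moreover have "eventually (\<lambda>u. (x u / y u - \<rho>) / v + a1 * (a1 * (x u / y u) + a2) -
      a1 * ((std_normal_rev_hazard (B u) + B u) * inverse (y u)) = c u / y u) F"
    using neg
  proof eventually_elim
    case (elim u)
    have "(x u / y u - \<rho>) / v = A u / v / y u"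
      using elim by (simp add: A_def field_simps)
    moreover have "a1 * (a1 * (x u / y u) + a2) = a1 * B u / y u"
      using elim by (simp add: B_def field_simps)
    ultimately show ?case by (simp add: c_def divide_inverse algebra_simps)
  qed
  ultimately have cy: "((\<lambda>u. c u / y u) \<longlongrightarrow> \<beta>) F"
    by (simp add: Lim_transform_eventually \<beta>_def v_def)
  have "filterlim (\<lambda>u. c u / y u * y u) at_bot F"
    by (intro filterlim_tendsto_pos_mult_at_bot[OF cy \<beta> y])
  then have c: "filterlim c at_bot F"
    by (rule filterlim_cong[THEN iffD1, OF refl refl, rotated])
       (use neg in \<open>eventually_elim, simp\<close>)
  have "(\<lambda>u. cond_cdf (sn2_density (a1, a2) \<rho>) (x u) (y u)) \<sim>[F]
    (\<lambda>u. exp (- (A u)\<^sup>2 / (2 * v)) * std_normal_cdf (B u) /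
      (sqrt (2 * pi) * sqrt v * std_normal_cdf (sn2_lambda2 (a1, a2) \<rho> * y u)) / \<bar>c u\<bar>)"
    using cond_cdf_sn2_asymp[OF \<rho>, of x y a1 a2 F] c
    unfolding A_def B_def c_def v_def by blast
  also have "\<dots> \<sim>[F] (\<lambda>u. exp (- (A u)\<^sup>2 / (2 * v) - (B u)\<^sup>2 / 2) /
      (2 * pi * sqrt v * \<beta> * \<bar>y u\<bar> * std_normal_cdf (sn2_lambda2 (a1, a2) \<rho> * y u) * \<bar>B u\<bar>))" (is "?f \<sim>[F] ?g")
  proof (rule asymp_equivI')
    have "((\<lambda>u. std_normal_cdf (B u) * \<bar>B u\<bar> / std_normal_density (B u) * (\<beta> * inverse (c u / y u))) \<longlongrightarrow>
        1 * (\<beta> * inverse \<beta>)) F"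
      using \<beta>
      by (intro tendsto_mult[OF filterlim_compose[OF std_normal_cdf_asymp_at_bot B]
            tendsto_mult[OF tendsto_const tendsto_inverse[OF cy]]]) simp
    moreover have "eventually (\<lambda>u. c u < 0) F"
      using c unfolding filterlim_at_bot_dense by blast
    with neg have "eventually (\<lambda>u. std_normal_cdf (B u) * \<bar>B u\<bar> / std_normal_density (B u) *
        (\<beta> * inverse (c u / y u)) = ?f u / ?g u) F"
    proof eventually_elim
      case (elim u)
      have e: "exp (- (A u)\<^sup>2 / (2 * v) - (B u)\<^sup>2 / 2) =
          exp (- (A u)\<^sup>2 / (2 * v)) * (std_normal_density (B u) * sqrt (2 * pi))"
      proof -
        have "std_normal_density (B u) * sqrt (2 * pi) = exp (- (B u)\<^sup>2 / 2)"
          by (simp add: std_normal_density_def)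
        then show ?thesis by (simp only: mult_exp_exp) simp
      qed
      \<comment> \<open>One factor \<open>sqrt (2 * pi)\<close> normalises the conditional Gaussian,
        the other comes from the density at B.\<close>
      have s: "2 * pi * sqrt v = sqrt (2 * pi) * sqrt (2 * pi) * sqrt v"
        by (subst real_sqrt_mult_self) simp
      have ratio: "P * \<bar>B\<bar> / d * (\<beta> * inverse (c / y)) =
          e * P / (p * s * N) / \<bar>c\<bar> / (e * (d * p) / (p * p * s * \<beta> * \<bar>y\<bar> * N * \<bar>B\<bar>))"
        if "0 < e" "0 < p" "0 < s" "0 < N" "c < 0" "y < 0" "0 < d" for e P p s N c y d B :: real
        using that \<beta> by (simp add: field_simps)
      show ?case
        unfolding e s
        by (rule ratio) (use elim v in \<open>simp_all add: std_normal_cdf_pos normal_density_pos del: std_normal_density_def\<close>)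
    qed
    ultimately show "((\<lambda>u. ?f u / ?g u) \<longlongrightarrow> 1) F"
      using \<beta> by (simp add: Lim_transform_eventually)
  qed
  finally show ?thesis unfolding v_def .
qed

subsection \<open>Signs of the limiting slopes\<close>

text \<open>One plus the quadratic form of the correlation matrix at the vector (a, b).\<close>

definition sn2_sq_sum :: "real \<Rightarrow> real \<Rightarrow> real \<Rightarrow> real" where
  "sn2_sq_sum a b \<rho> = 1 + a\<^sup>2 + b\<^sup>2 + 2 * \<rho> * a * b"

lemma sn2_sq_sum_eq:
  "sn2_sq_sum a b \<rho> = 1 + b\<^sup>2 * (1 - \<rho>\<^sup>2) + (a + \<rho> * b)\<^sup>2"
  "sn2_sq_sum a b \<rho> = 1 + a\<^sup>2 * (1 - \<rho>\<^sup>2) + (b + \<rho> * a)\<^sup>2"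
  by (simp_all add: sn2_sq_sum_def power2_eq_square algebra_simps)

text \<open>
  The closed form of \<open>\<gamma>\<^sub>1\<close> with squares and denominators cleared. The numerators \<open>a + \<rho>b\<close> and \<open>b + \<rho>a\<close>
  have the signs of \<open>\<lambda>\<^sub>1\<close> and \<open>\<lambda>\<^sub>2\<close>, and \<open>1 + \<lambda>\<^sub>1\<^sup>2\<close>, \<open>1 + \<lambda>\<^sub>2\<^sup>2\<close> share the numerator \<open>sn2_sq_sum a b \<rho>\<close>.
\<close>

definition is_sn2_gamma :: "real \<Rightarrow> real \<Rightarrow> real \<Rightarrow> real \<Rightarrow> bool" where
  "is_sn2_gamma a b \<rho> g \<longleftrightarrow> 0 < g \<and>
     (if a + \<rho> * b > 0 \<and> b + \<rho> * a > 0 then g\<^sup>2 * (1 + a\<^sup>2 * (1 - \<rho>\<^sup>2)) = 1 + b\<^sup>2 * (1 - \<rho>\<^sup>2)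
      else if b + \<rho> * a > 0 then g\<^sup>2 * (1 + a\<^sup>2 * (1 - \<rho>\<^sup>2)) = sn2_sq_sum a b \<rho>
      else if a + \<rho> * b > 0 then g\<^sup>2 * sn2_sq_sum a b \<rho> = 1 + b\<^sup>2 * (1 - \<rho>\<^sup>2)
      else g = 1)"

text \<open>If g \<le> \<rho>, then 0 < g < 1 and \<rho> > 0, and each of the four sign patterns in
  the closed form of g becomes contradictory.\<close>

lemma is_sn2_gamma_gt_corr:
  assumes \<rho>: "-1 < \<rho>" "\<rho> < 1" and a: "a \<noteq> 0" and g: "is_sn2_gamma a b \<rho> g" and k: "a * g + b \<le> 0"
  shows "\<rho> < g"
proof (rule ccontr)
  assume "\<not> \<rho> < g"
  define v where "v = 1 - \<rho>\<^sup>2"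
  have v: "0 < v" using \<rho> by (simp add: v_def abs_square_less_1)
  have g0: "0 < g" using g by (simp add: is_sn2_gamma_def)
  with \<open>\<not> \<rho> < g\<close> \<rho> have r0: "0 < \<rho>" and g1: "g < 1" and gr: "g \<le> \<rho>" by auto
  have gg: "g\<^sup>2 < 1" using g0 g1 by (simp add: power_less_one_iff)
  have av: "0 < 1 + a\<^sup>2 * v" using v by (simp add: add_pos_nonneg)
  have lt: "g\<^sup>2 * (1 + a\<^sup>2 * v) < 1 + a\<^sup>2 * v"
    using mult_strict_right_mono[OF gg av] by simp
  consider (pp) "a + \<rho> * b > 0" "b + \<rho> * a > 0" | (np) "a + \<rho> * b \<le> 0" "b + \<rho> * a > 0"
    | (pn) "a + \<rho> * b > 0" "b + \<rho> * a \<le> 0" | (nn) "a + \<rho> * b \<le> 0" "b + \<rho> * a \<le> 0"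
    by linarith
  then show False
  proof cases
    case pp
    then have e: "g\<^sup>2 * (1 + a\<^sup>2 * v) = 1 + b\<^sup>2 * v" using g by (simp add: is_sn2_gamma_def v_def)
    show False
    \<comment> \<open>If a < 0, then a + \<rho> b > 0 forces |a| < b, so e would give g > 1. If a >
      0, the hypothesis on a g + b gives (a g)^2 \<le> b^2, and e then forces g^2 \<ge> 1.\<close>
    proof (cases "a < 0")
      case True
      have "b > 0" using pp(1) True r0 mult_nonneg_nonpos[of \<rho> b] by linarith
      then have "\<rho> * b < b" using \<rho> by simp
      then have "\<bar>a\<bar> < \<bar>b\<bar>" using pp(1) True by linarith
      then have "a\<^sup>2 * v < b\<^sup>2 * v" using v by (intro mult_strict_right_mono) (simp_all add: power2_strict_mono)
      then show False using lt e by simp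
    next
      case False
      then have "0 < a * g" using a g0 by simp
      then have "(a * g)\<^sup>2 \<le> (- b)\<^sup>2" using k by (intro power_mono) auto
      then have "g\<^sup>2 * a\<^sup>2 * v \<le> b\<^sup>2 * v" using v by (simp add: power_mult_distrib mult_ac)
      then show False using e gg by (simp add: algebra_simps)
    qed
  next
    case np
    then have "g\<^sup>2 * (1 + a\<^sup>2 * v) = 1 + a\<^sup>2 * v + (b + \<rho> * a)\<^sup>2"
      using g by (simp add: is_sn2_gamma_def v_def sn2_sq_sum_eq(2))
    then show False using lt by (smt (verit) zero_le_power2)
  next
    case pn
    then have e: "g\<^sup>2 * (1 + b\<^sup>2 * v + (a + \<rho> * b)\<^sup>2) = 1 + b\<^sup>2 * v"
      using g by (simp add: is_sn2_gamma_def v_def sn2_sq_sum_eq(1))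
    \<comment> \<open>With g \<le> \<rho>, the equation e yields v (1 + b^2 v) \<le> \<rho>^2 (a +
      \<rho> b)^2, while b + \<rho> a \<le> 0 bounds the right side by v b^2 v. Together they give v
      \<le> 0.\<close>
    have "g\<^sup>2 \<le> \<rho>\<^sup>2" using gr g0 by (intro power_mono) auto
    then have le: "1 + b\<^sup>2 * v \<le> \<rho>\<^sup>2 * (1 + b\<^sup>2 * v + (a + \<rho> * b)\<^sup>2)"
      using e v by (smt (verit) mult_right_mono mult_nonneg_nonneg zero_le_power2)
    have "v * (1 + b\<^sup>2 * v) = (1 + b\<^sup>2 * v) - \<rho>\<^sup>2 * (1 + b\<^sup>2 * v)"
      by (simp add: v_def left_diff_distrib)
    also have "\<dots> \<le> \<rho>\<^sup>2 * (a + \<rho> * b)\<^sup>2"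
      using le unfolding distrib_left[of "\<rho>\<^sup>2" "1 + b\<^sup>2 * v" "(a + \<rho> * b)\<^sup>2"] by linarith
    also have "\<dots> = (\<rho> * (a + \<rho> * b))\<^sup>2" by (simp only: power_mult_distrib)
    also have "\<dots> \<le> (- b * v)\<^sup>2"
    proof (rule power_mono)
      show "\<rho> * (a + \<rho> * b) \<le> - b * v"
        using pn by (simp add: v_def power2_eq_square algebra_simps)
      show "0 \<le> \<rho> * (a + \<rho> * b)" using pn r0 by simp
    qed
    also have "\<dots> = v * (b\<^sup>2 * v)" by (simp add: power2_eq_square mult_ac)
    finally show False using v by (simp add: algebra_simps)
  next
    case nn
    then show False using g g1 by (simp add: is_sn2_gamma_def)
  qed
qed

lemma sn2_beta_pos:
  assumes \<rho>: "-1 < \<rho>" "\<rho> < 1" and a: "a \<noteq> 0" and g: "is_sn2_gamma a b \<rho> g" and k: "a * g + b \<ge> 0"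
  shows "0 < (g - \<rho>) / (1 - \<rho>\<^sup>2) + a * (a * g + b)"
proof -
  define v where "v = 1 - \<rho>\<^sup>2"
  have v: "0 < v" using \<rho> by (simp add: v_def abs_square_less_1)
  have g0: "0 < g" using g by (simp add: is_sn2_gamma_def)
  \<comment> \<open>The claimed quantity is (g (1 + a^2 v) - (\<rho> - a b v)) / v. A Cauchy-Schwarz
    type identity bounds (\<rho> - a b v)^2 strictly by (1 + b^2 v) (1 + a^2 v), with a gap of v
    times one plus a nonnegative quadratic form.\<close>
  have pos_if: "0 < (g - \<rho>) / v + a * (a * g + b)" if ge: "1 + b\<^sup>2 * v \<le> g\<^sup>2 * (1 + a\<^sup>2 * v)"
  proof -
    have "a\<^sup>2 + b\<^sup>2 + 2 * \<rho> * a * b = (a + \<rho> * b)\<^sup>2 + b\<^sup>2 * v"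
      by (simp add: v_def power2_eq_square algebra_simps)
    then have q: "0 \<le> v * (a\<^sup>2 + b\<^sup>2 + 2 * \<rho> * a * b)"
      using v by simp
    have "(\<rho> - a * b * v)\<^sup>2 + (v + v * (a\<^sup>2 + b\<^sup>2 + 2 * \<rho> * a * b)) = (1 + b\<^sup>2 * v) * (1 + a\<^sup>2 * v)"
      by (simp add: v_def power2_eq_square algebra_simps)
    then have "(\<rho> - a * b * v)\<^sup>2 < (1 + b\<^sup>2 * v) * (1 + a\<^sup>2 * v)" using q v by linarith
    also have "\<dots> \<le> (g\<^sup>2 * (1 + a\<^sup>2 * v)) * (1 + a\<^sup>2 * v)"
      using v by (intro mult_right_mono ge) simp
    also have "\<dots> = (g * (1 + a\<^sup>2 * v))\<^sup>2" by (simp add: power2_eq_square mult_ac)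
    finally have "\<rho> - a * b * v < g * (1 + a\<^sup>2 * v)"
      by (rule power2_less_imp_less) (use g0 v in simp)
    then have "0 < (g * (1 + a\<^sup>2 * v) - (\<rho> - a * b * v)) / v" using v by simp
    also have "\<dots> = (g - \<rho>) / v + a * (a * g + b)"
      using v by (simp add: field_simps power2_eq_square)
    finally show ?thesis .
  qed
  consider (pp) "a + \<rho> * b > 0" "b + \<rho> * a > 0" | (np) "a + \<rho> * b \<le> 0" "b + \<rho> * a > 0"
    | (pn) "a + \<rho> * b > 0" "b + \<rho> * a \<le> 0" | (nn) "a + \<rho> * b \<le> 0" "b + \<rho> * a \<le> 0"
    by linarith
  then show ?thesis unfolding v_def[symmetric]
  proof cases
    case pp
    then show "0 < (g - \<rho>) / v + a * (a * g + b)" using g by (intro pos_if) (simp add: is_sn2_gamma_def v_def)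
  next
    case np
    then show "0 < (g - \<rho>) / v + a * (a * g + b)"
      using g by (intro pos_if) (simp add: is_sn2_gamma_def v_def sn2_sq_sum_eq(1))
  next
    case pn
    have a0: "0 < a"
    proof (rule ccontr)
      assume "\<not> 0 < a"
      then have neg: "a < 0" using a by simp
      then have b: "0 < b" using k mult_neg_pos[OF neg g0] by linarith
      have "a * v = (a + \<rho> * b) - \<rho> * (b + \<rho> * a)" by (simp add: v_def power2_eq_square algebra_simps)
      moreover have "a * v < 0" using neg v by (simp add: mult_neg_pos)
      ultimately have "\<rho> * (b + \<rho> * a) > 0" using pn by linarith
      then have "\<rho> < 0" using pn(2) by (simp add: zero_less_mult_iff)
      then have "0 < \<rho> * a" using neg by (simp add: mult_neg_neg)
      then show False using b pn(2) by linarith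
    qed
    \<comment> \<open>Both summands of \<beta> are now nonnegative; if the second vanishes, the
      first is positive by the preceding lemma.\<close>
    have gr: "\<rho> \<le> g"
    proof -
      have "\<rho> * a \<le> g * a" using pn(2) k by (simp add: mult.commute)
      then show ?thesis using a0 by simp
    qed
    show "0 < (g - \<rho>) / v + a * (a * g + b)"
    proof (cases "a * g + b = 0")
      case True
      then show ?thesis using is_sn2_gamma_gt_corr[OF \<rho> a g] v by simp
    next
      case False
      then have "0 < a * (a * g + b)" using a0 k by simp
      moreover have "0 \<le> (g - \<rho>) / v" using gr v by simp
      ultimately show ?thesis by linarith
    qed
  next
    case nn
    then have g1: "g = 1" using g by (simp add: is_sn2_gamma_def)
    have "(1 + \<rho>) * (a + b) \<le> 0" using nn by (simp add: algebra_simps)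
    then have "a + b \<le> 0" using \<rho> by (simp add: mult_le_0_iff)
    then have "a + b = 0" using k g1 by simp
    then show "0 < (g - \<rho>) / v + a * (a * g + b)" using g1 \<rho> v by simp
  qed
qed

lemma is_sn2_gamma_sn2_gamma1:
  assumes M: "prob_space M" and \<rho>: "-1 < \<rho>" "\<rho> < 1" and Z: "skew_normal2 M Z (a, b) \<rho>"
  shows "is_sn2_gamma a b \<rho> (sn2_gamma1 M Z)"
proof -
  define v where "v = 1 - \<rho>\<^sup>2"
  have v: "0 < v" using \<rho> by (simp add: v_def abs_square_less_1)
  define l1 where "l1 = sn2_lambda1 (a, b) \<rho>"
  define l2 where "l2 = sn2_lambda2 (a, b) \<rho>"
  have av: "0 < 1 + a\<^sup>2 * v" and bv: "0 < 1 + b\<^sup>2 * v" using v by (auto intro: add_pos_nonneg)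
  have D: "0 < sn2_sq_sum a b \<rho>" using av by (simp add: sn2_sq_sum_eq(2) v_def add_pos_nonneg)
  have s1: "l1 > 0 \<longleftrightarrow> a + \<rho> * b > 0" and s2: "l2 > 0 \<longleftrightarrow> b + \<rho> * a > 0"
    using av bv by (simp_all add: l1_def l2_def sn2_lambda1_def sn2_lambda2_def v_def zero_less_divide_iff)
  have e1: "1 + l1\<^sup>2 = sn2_sq_sum a b \<rho> / (1 + b\<^sup>2 * v)"
    using bv by (simp add: l1_def sn2_lambda1_def v_def[symmetric] power_divide sn2_sq_sum_eq(1) field_simps)
  have e2: "1 + l2\<^sup>2 = sn2_sq_sum a b \<rho> / (1 + a\<^sup>2 * v)"
    using av by (simp add: l2_def sn2_lambda2_def v_def[symmetric] power_divide sn2_sq_sum_eq(2) field_simps)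
  have g: "sn2_gamma1 M Z = (if l1 > 0 \<and> l2 > 0 then sqrt ((1 + l2\<^sup>2) / (1 + l1\<^sup>2))
       else if l1 \<le> 0 \<and> l2 > 0 then sqrt (1 + l2\<^sup>2)
       else if l1 > 0 \<and> l2 \<le> 0 then 1 / sqrt (1 + l1\<^sup>2) else 1)"
    using sn2_gamma1_tendsto(2)[OF M \<rho> Z] by (simp only: l1_def l2_def Let_def)
  show ?thesis
    unfolding is_sn2_gamma_def v_def[symmetric] s1[symmetric] s2[symmetric] g
    using av bv D by (auto simp: e1 e2 power_divide)
qed

section \<open>Combination of the three cases\<close>

theorem theorem2:
  fixes M :: "'a measure" and Z :: "'a \<Rightarrow> real \<times> real" and \<alpha>\<^sub>1 \<alpha>\<^sub>2 \<rho> :: real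
  assumes "prob_space M"
    and "-1 < \<rho>" and "\<rho> < 1" and "\<alpha>\<^sub>1 \<noteq> 0"
    and "skew_normal2 M Z (\<alpha>\<^sub>1, \<alpha>\<^sub>2) \<rho>"
  shows
    "(filterlim (sn2_B M Z (\<alpha>\<^sub>1, \<alpha>\<^sub>2)) at_bot (at_right 0) \<and>
     (filterlim (sn2_A1 M Z \<rho>) at_bot (at_right 0) \<or>
      (sn2_A1 M Z \<rho> \<longlongrightarrow> 0) (at_right 0) \<or>
      filterlim (sn2_A1 M Z \<rho>) at_top (at_right 0)) \<longrightarrow>
     sn2_beta1 M Z (\<alpha>\<^sub>1, \<alpha>\<^sub>2) \<rho> > 0 \<and>
     (\<lambda>u. cond_cdf (sn2_density (\<alpha>\<^sub>1, \<alpha>\<^sub>2) \<rho>) (quantile1 M Z u) (quantile2 M Z u))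
       \<sim>[at_right 0]
     (\<lambda>u. exp (- (sn2_A1 M Z \<rho> u)\<^sup>2 / (2 * (1 - \<rho>\<^sup>2)) - (sn2_B M Z (\<alpha>\<^sub>1, \<alpha>\<^sub>2) u)\<^sup>2 / 2)
        / (2 * pi * sqrt (1 - \<rho>\<^sup>2) * sn2_beta1 M Z (\<alpha>\<^sub>1, \<alpha>\<^sub>2) \<rho> * \<bar>quantile2 M Z u\<bar>
           * std_normal_cdf (sn2_lambda2 (\<alpha>\<^sub>1, \<alpha>\<^sub>2) \<rho> * quantile2 M Z u)
           * \<bar>sn2_B M Z (\<alpha>\<^sub>1, \<alpha>\<^sub>2) u\<bar>))) \<and>
     ((sn2_B M Z (\<alpha>\<^sub>1, \<alpha>\<^sub>2) \<longlongrightarrow> 0) (at_right 0) \<longrightarrow>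
     filterlim (sn2_A1 M Z \<rho>) at_bot (at_right 0) \<and>
     (\<lambda>u. cond_cdf (sn2_density (\<alpha>\<^sub>1, \<alpha>\<^sub>2) \<rho>) (quantile1 M Z u) (quantile2 M Z u))
       \<sim>[at_right 0]
     (\<lambda>u. sqrt (1 - \<rho>\<^sup>2) * exp (- (sn2_A1 M Z \<rho> u)\<^sup>2 / (2 * (1 - \<rho>\<^sup>2)))
        / (2 * sqrt (2 * pi) * \<bar>sn2_A1 M Z \<rho> u\<bar>
           * std_normal_cdf (sn2_lambda2 (\<alpha>\<^sub>1, \<alpha>\<^sub>2) \<rho> * quantile2 M Z u)))) \<and>
     (filterlim (sn2_B M Z (\<alpha>\<^sub>1, \<alpha>\<^sub>2)) at_top (at_right 0) \<longrightarrow>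
     filterlim (sn2_A1 M Z \<rho>) at_bot (at_right 0) \<and>
     (\<lambda>u. cond_cdf (sn2_density (\<alpha>\<^sub>1, \<alpha>\<^sub>2) \<rho>) (quantile1 M Z u) (quantile2 M Z u))
       \<sim>[at_right 0]
     (\<lambda>u. sqrt (1 - \<rho>\<^sup>2) * exp (- (sn2_A1 M Z \<rho> u)\<^sup>2 / (2 * (1 - \<rho>\<^sup>2)))
        / (sqrt (2 * pi) * \<bar>sn2_A1 M Z \<rho> u\<bar>
           * std_normal_cdf (sn2_lambda2 (\<alpha>\<^sub>1, \<alpha>\<^sub>2) \<rho> * quantile2 M Z u))))"
proof -
  define x where "x = quantile1 M Z"
  define y where "y = quantile2 M Z"
  define g where "g = sn2_gamma1 M Z"
  \<comment> \<open>The limit of B / y. As y tends to -\<infinity>, the limit of B determines the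
    sign of k: B \<rightarrow> -\<infinity> gives k \<ge> 0, B \<rightarrow> 0 gives k = 0, and B
    \<rightarrow> \<infinity> gives k \<le> 0.\<close>
  define k where "k = \<alpha>\<^sub>1 * g + \<alpha>\<^sub>2"
  note asms = assms(1,2,3,5)
  have A: "sn2_A1 M Z \<rho> = (\<lambda>u. x u - \<rho> * y u)"
    by (simp add: sn2_A1_def x_def y_def fun_eq_iff)
  have B: "sn2_B M Z (\<alpha>\<^sub>1, \<alpha>\<^sub>2) = (\<lambda>u. \<alpha>\<^sub>1 * x u + \<alpha>\<^sub>2 * y u)"
    by (simp add: sn2_B_def x_def y_def fun_eq_iff)
  have \<beta>: "sn2_beta1 M Z (\<alpha>\<^sub>1, \<alpha>\<^sub>2) \<rho> = (g - \<rho>) / (1 - \<rho>\<^sup>2) + \<alpha>\<^sub>1 * (\<alpha>\<^sub>1 * g + \<alpha>\<^sub>2)"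
    by (simp add: sn2_beta1_def g_def)
  have y: "filterlim y at_bot (at_right 0)"
    by (simp add: y_def quantile_def skew_normal2_marginals[OF asms] inv_cdf_sn_dist_at_bot)
  have ratio: "((\<lambda>u. x u / y u) \<longlongrightarrow> g) (at_right 0)"
    unfolding x_def y_def g_def by (rule sn2_gamma1_tendsto(1)[OF asms])
  have g: "is_sn2_gamma \<alpha>\<^sub>1 \<alpha>\<^sub>2 \<rho> g"
    unfolding g_def by (rule is_sn2_gamma_sn2_gamma1[OF asms])
  have neg: "eventually (\<lambda>u. y u < 0) (at_right 0)"
    using y unfolding filterlim_at_bot_dense by blast
  have Bk: "((\<lambda>u. (\<alpha>\<^sub>1 * x u + \<alpha>\<^sub>2 * y u) / y u) \<longlongrightarrow> k) (at_right 0)"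
  proof -
    have "((\<lambda>u. \<alpha>\<^sub>1 * (x u / y u) + \<alpha>\<^sub>2) \<longlongrightarrow> k) (at_right 0)"
      unfolding k_def by (intro tendsto_intros ratio)
    moreover have "eventually (\<lambda>u. \<alpha>\<^sub>1 * (x u / y u) + \<alpha>\<^sub>2 = (\<alpha>\<^sub>1 * x u + \<alpha>\<^sub>2 * y u) / y u) (at_right 0)"
      using neg by eventually_elim (simp add: field_simps)
    ultimately show ?thesis by (rule Lim_transform_eventually)
  qed
  have A_bot: "filterlim (\<lambda>u. x u - \<rho> * y u) at_bot (at_right 0)" if "k \<le> 0"
  proof -
    have "\<rho> < g" using is_sn2_gamma_gt_corr[OF assms(2-4) g] that by (simp add: k_def)
    moreover have "((\<lambda>u. x u / y u - \<rho>) \<longlongrightarrow> g - \<rho>) (at_right 0)"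
      by (intro tendsto_intros ratio)
    ultimately have "filterlim (\<lambda>u. (x u / y u - \<rho>) * y u) at_bot (at_right 0)"
      by (intro filterlim_tendsto_pos_mult_at_bot[OF _ _ y]) auto
    then show ?thesis
      by (rule filterlim_cong[THEN iffD1, OF refl refl, rotated])
         (use neg in \<open>eventually_elim, simp add: field_simps\<close>)
  qed
  have k_nonneg: "0 \<le> k" if "filterlim (\<lambda>u. \<alpha>\<^sub>1 * x u + \<alpha>\<^sub>2 * y u) at_bot (at_right 0)"
  proof -
    have "eventually (\<lambda>u. \<alpha>\<^sub>1 * x u + \<alpha>\<^sub>2 * y u \<le> 0) (at_right 0)"
      using that by (simp add: filterlim_at_bot)
    with neg have "eventually (\<lambda>u. 0 \<le> (\<alpha>\<^sub>1 * x u + \<alpha>\<^sub>2 * y u) / y u) (at_right 0)"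
      by eventually_elim (simp add: divide_nonpos_nonpos)
    then show ?thesis by (rule tendsto_lowerbound[OF Bk]) simp
  qed
  have k_zero: "k = 0" if "((\<lambda>u. \<alpha>\<^sub>1 * x u + \<alpha>\<^sub>2 * y u) \<longlongrightarrow> 0) (at_right 0)"
  proof -
    have "((\<lambda>u. (\<alpha>\<^sub>1 * x u + \<alpha>\<^sub>2 * y u) / y u) \<longlongrightarrow> 0) (at_right 0)"
      by (rule tendsto_divide_0[OF that filterlim_at_bot_imp_at_infinity[OF y]])
    then show ?thesis using Bk tendsto_unique trivial_limit_at_right_real by blast
  qed
  have k_nonpos: "k \<le> 0" if "filterlim (\<lambda>u. \<alpha>\<^sub>1 * x u + \<alpha>\<^sub>2 * y u) at_top (at_right 0)"
  proof -
    have "eventually (\<lambda>u. 0 \<le> \<alpha>\<^sub>1 * x u + \<alpha>\<^sub>2 * y u) (at_right 0)"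
      using that by (simp add: filterlim_at_top)
    with neg have "eventually (\<lambda>u. (\<alpha>\<^sub>1 * x u + \<alpha>\<^sub>2 * y u) / y u \<le> 0) (at_right 0)"
      by eventually_elim (simp add: divide_nonneg_nonpos)
    then show ?thesis by (rule tendsto_upperbound[OF Bk]) simp
  qed
  have \<beta>_pos: "0 < (g - \<rho>) / (1 - \<rho>\<^sup>2) + \<alpha>\<^sub>1 * (\<alpha>\<^sub>1 * g + \<alpha>\<^sub>2)" if "0 \<le> k"
    using sn2_beta_pos[OF assms(2-4) g] that by (simp add: k_def)
  show ?thesis
    unfolding A B \<beta> x_def[symmetric] y_def[symmetric]
  \<comment> \<open>The goals come in pairs, one for each of (a), (b), (c): first the sign of
    \<beta> or the limit of A, then the equivalence.\<close>
  proof (intro conjI impI, goal_cases)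
    case 1
    then show ?case using k_nonneg \<beta>_pos by blast
  next
    case 2
    then have bot: "filterlim (\<lambda>u. \<alpha>\<^sub>1 * x u + \<alpha>\<^sub>2 * y u) at_bot (at_right 0)" by blast
    from cond_cdf_sn2_asymp_cdf_null[OF assms(2,3) y ratio this \<beta>_pos[OF k_nonneg[OF this]]]
    show ?case .
  next
    case 3
    then show ?case using A_bot k_zero by simp
  next
    case 4
    have "((\<lambda>u. std_normal_cdf (\<alpha>\<^sub>1 * x u + \<alpha>\<^sub>2 * y u)) \<longlongrightarrow> 1 / 2) (at_right 0)"
      using isCont_tendsto_compose[OF DERIV_isCont[OF std_normal_cdf_has_real_derivative] 4]
      by (simp add: std_normal_cdf_0)
    from cond_cdf_sn2_asymp_cdf_pos_limit[OF assms(2,3) A_bot this] k_zero[OF 4]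
    show ?case by (simp add: mult.assoc)
  next
    case 5
    then show ?case by (intro A_bot k_nonpos)
  next
    case 6
    interpret N: prob_space std_normal_distribution by (rule prob_space_normal_density) simp
    interpret R: real_distribution std_normal_distribution by standard auto
    have "((\<lambda>u. std_normal_cdf (\<alpha>\<^sub>1 * x u + \<alpha>\<^sub>2 * y u)) \<longlongrightarrow> 1) (at_right 0)"
      by (rule filterlim_compose[OF R.cdf_lim_at_top_prob 6])
    from cond_cdf_sn2_asymp_cdf_pos_limit[OF assms(2,3) A_bot[OF k_nonpos[OF 6]] this]
    show ?case by simp
  qed
qed

end
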